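(* Let $\Bbbk$ be a field, $\mathsf C$ a small category and $\mathcal A:\mathsf C\to\mathsf{Vec}_\Bbbk$ a functor. For $p,q\in\mathbb N$ let $\bar C^{p,q}(\mathcal A,\mathcal A)$ be the set of $f\in C^{p,q}(\mathcal A,\mathcal A)$ such that $f[\boldsymbol\phi]=0$ whenever some component of $\boldsymbol\phi\in B_p\mathsf C$ is an identity morphism, and let the reduced subcomplex $\bar C^{\bullet,\bullet}(\mathcal A,\mathcal A)$ be spanned by these cochains. Then $\mathsf s_2\bar C^{\bullet,\bullet}(\mathcal A,\mathcal A)$ is a $\mathit{Quilt}$-subalgebra of $\mathsf s_2C^{\bullet,\bullet}(\mathcal A,\mathcal A)$ (a subcomplex for $\delta^{\mathrm S}$ closed under all the operations $\widehat Q$, $Q$ a quilt).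
   Context: Write $\langle n\rangle=\{1,\dots,n\}$, $[p]=\{0,\dots,p\}$. TREES. A tree $T$ consists of a finite set $V_T$ (vertices), a set $E_T\subset V_T\times V_T$ (edges) and a partial order $\trianglelefteq_T$ on $V_T$ (strict part $\vartriangleleft_T$) such that: $(u,u)\notin E_T$; $E_T$ generates a partial order $\le_T$ with $(u,v)\in E_T\Rightarrow u<_Tv$; there is a unique $\le_T$-minimal vertex (the root); if $(u,v)\in E_T$ there is no $t$ with $u<_Tt<_Tv$; for all $u,v$ exactly one of $u=v$, $u<_Tv$, $u>_Tv$, $u\vartriangleleft_Tv$, $u\vartriangleright_Tv$ holds; if $u\vartriangleleft_Tv$, $u\le_Tu'$, $v\le_Tv'$ then $u'\vartriangleleft_Tv'$. If $(u,v)\in E_T$, $v$ is a child of $u$. $\mathsf{Tree}(n)$ is the set of trees with vertex set $\langle n\rangle$. WORDS. $\mathsf{F_2S}(n)$ is the set of words (finite sequences) $W$ over $\langle n\rangle$ such that every element of $\langle n\rangle$ appears, no element appears twice consecutively, and for $u\ne v$ there is no subsequence $u,v,u,v$. $|W|$ is the length and $\deg W=|W|-n$. Elements of $\langle n\rangle$ are called vertices. QUILTS. $\mathsf{Quilt}(n)$ is the set of pairs $Q=(W_Q,T_Q)\in\mathsf{F_2S}(n)\times\mathsf{Tree}(n)$ such that (1) if some occurrence of $u$ precedes some occurrence of $v$ in $W_Q$ then not $u>_{T_Q}v$; (2) if some occurrence of $v$ lies between two occurrences of $u$ in $W_Q$ then $v\trianglelefteq_{T_Q}u$. $\deg Q=\deg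 W_Q$, arity $\#Q=n$. The quilts of arity $n$ span the arity $n$ part of a dg-operad $\mathit{Quilt}$, which acts on $\mathsf s_2C^{\bullet,\bullet}(\mathcal A,\mathcal A)$ by the operations $\widehat Q$ below. OCCURRENCES. $\underline a$ denotes an occurrence (position) of $a$ in $W$. The $\downarrow$ order is the order of first occurrences in $W$. If $W=\dots uv\dots u\dots$ ($v$ immediately after an occurrence of $u$, and $u$ occurs again later), $v$ is interposed; there are $\deg W$ interposed vertices. COCHAINS. $B_p\mathsf C$ is the set of strings $\boldsymbol\phi=(\phi_1,\dots,\phi_p)$, $x_0\xleftarrow{\phi_1}x_1\leftarrow\dots\xleftarrow{\phi_p}x_p$ in $\mathsf C$ (objects if $p=0$). $\phi_{k,l}=\phi_{k+1}\circ\dots\circ\phi_l:x_l\to x_k$ (identity if $k=l$). For strictly increasing $\zeta:[p]\to[p']$ and $\boldsymbol\phi\in B_{p'}\mathsf C$, $\zeta^*\boldsymbol\phi=(\phi_{\zeta(0),\zeta(1)},\dots,\phi_{\zeta(p-1),\zeta(p)})\in B_p\mathsf C$ (the object $x_{\zeta(0)}$ if $p=0$). $C^{p,q}(\mathcal A,\mathcal A)=\prod_{(x_0\leftarrow\dots\leftarrow x_p)\in B_p\mathsf C}\operatorname{Hom}_\Bbbk(\mathcal A(x_p)^{\otimes q},\mathcal A(x_0))$; the component of $f$ at $\boldsymbol\phi$ is $f[\boldsymbol\phi]$. For $f\in C^{p,q}$, the shifted bidegree is $\|f\|=(p,q-1)$ and $|f|=p+q-1$; $\mathsf s_2C^{\bullet,\bullet}$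 is $C^{\bullet,\bullet}$ graded by shifted bidegree. $\delta^{\mathrm S}:C^{p,q}\to C^{p+1,q}$ is $\delta^{\mathrm S}=\sum_{i=0}^{p+1}(-1)^i\delta^{\mathrm S}_i$, $(\delta^{\mathrm S}_if)[\boldsymbol\phi]=\mathcal A[\phi_{0,\varepsilon_i(0)}]\circ f[\varepsilon_i^*\boldsymbol\phi]\circ\mathcal A[\phi_{\varepsilon_i(p),p+1}]^{\otimes q}$, where $\varepsilon_i:[p]\to[p+1]$ is the strictly increasing map whose image omits $i$. COLORINGS. Let $T\in\mathsf{Tree}(n)$, $W\in\mathsf{F_2S}(n)$, $\mathbf p,\mathbf q\in\mathbb N^n$ ($\mathbb N\ni0$), $q'=1+\sum_a(q_a-1)$, $p'=\sum_ap_a-\deg W$. $\mathrm{Clr}(T;\mathbf q)$ is the set of $I:E_T\to\mathbb N$ with $1\le I_{(u,v)}\le q_u$ for every edge, and $I_{(t,u)}<I_{(t,v)}$ whenever $u\vartriangleleft_Tv$ are children of $t$. $\mathrm{Clr}(W;\mathbf p)$ is the set of tuples $\boldsymbol\zeta=(\zeta_1,\dots,\zeta_n)$ of strictly increasing maps $\zeta_a:[p_a]\to[p']$ with $\bigcup_a\operatorname{Im}\zeta_a=[p']$ for which there exist (necessarily unique) functions $\pi_a:[p_a]\to W$ such that the image of $\pi_a$ is the set of occurrences of $a$ in $W$; $\zeta_a(\pi_a^{-1}\underline a)$ is a set of consecutive integers for every occurrence $\underline a$; and whenever $\underline b$ immediately follows $\underline a$ in $W$, $\max\zeta_a(\pi_a^{-1}\underline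 a)=\min\zeta_b(\pi_b^{-1}\underline b)$. (Empty if $p'<0$.) For a quilt $Q$, $\boldsymbol\zeta\in\mathrm{Clr}(W_Q;\mathbf p)$, $I\in\mathrm{Clr}(T_Q;\mathbf q)$, one has $\max\zeta_a\le\min\zeta_b$ for each edge $(a,b)$. ACTION OF A COLORING. For $f_a\in C^{p_a,q_a}(\mathcal A,\mathcal A)$ and $\boldsymbol\phi\in B_{p'}\mathsf C$, $\mathcal L(\boldsymbol\zeta,I;f_1,\dots,f_n)[\boldsymbol\phi]:\mathcal A(x_{p'})^{\otimes q'}\to\mathcal A(x_0)$ is the composite of the multilinear maps $f_a[\zeta_a^*\boldsymbol\phi]:\mathcal A(x_{\zeta_a(p_a)})^{\otimes q_a}\to\mathcal A(x_{\zeta_a(0)})$ along the tree: for each edge $(a,b)$ the output of $f_b[\zeta_b^*\boldsymbol\phi]$, after applying $\mathcal A[\phi_{\zeta_a(p_a),\zeta_b(0)}]$, is inserted in the $I_{(a,b)}$-th input of $f_a[\zeta_a^*\boldsymbol\phi]$; each input of $f_a[\zeta_a^*\boldsymbol\phi]$ not used by an edge is precomposed with $\mathcal A[\phi_{\zeta_a(p_a),p'}]$ (remaining inputs in planar order); the output at the root $u$ is followed by $\mathcal A[\phi_{0,\zeta_u(0)}]$. SIGNS. Use letters $0_{\mathrm va},\dots,(p_a-1)_{\mathrm va}$ and $1_{\mathrm ha},\dots,(q_a-1)_{\mathrm ha}$ for each vertex $a$. Initial word: the concatenation over $a=1,\dots,\#Q$ (in this order) of $0_{\mathrm va}\dots(p_a-1)_{\mathrm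 va}1_{\mathrm ha}\dots(q_a-1)_{\mathrm ha}$. Shuffled word: the concatenation of three words: (i) $0_{\mathrm va}$ for each interposed vertex $a$ of $W_Q$, in reverse $\downarrow$ order; (ii) the word having $i_{\mathrm va}$ in position $\zeta_a(i)$ (positions counted from $0$), for $0\le i\le p_a-1$ if $a$ is not interposed and $1\le i\le p_a-1$ if $a$ is interposed; (iii) the word obtained from the corner word of $T_Q$ (the word $C(\mathrm{root})$, where $C(v)=v\,C(c_1)\,v\,C(c_2)\,v\dots C(c_r)\,v$ for a vertex with children $c_1\vartriangleleft\dots\vartriangleleft c_r$) by replacing, in order, each non-last occurrence of $a$ immediately followed by $b$ with the next unused horizontal letters of $a$ up to $(I_{(a,b)}-1)_{\mathrm ha}$, and the last occurrence of $a$ with the remaining horizontal letters of $a$. If $p_a\ge1$ for all interposed $a$ and $q_a\ge1$ for all $a$, $\operatorname{sgn}_Q(\boldsymbol\zeta,I)$ is the sign of the permutation taking the initial word to the shuffled word. Otherwise it is defined by replacing each $q_a=0$ by $2$, and, for each interposed $a$ with $p_a=0$ (so $a$ occurs only once, at $\underline a$), replacing $\boldsymbol\zeta$ by $E_{\underline a}E_{\underline a}\boldsymbol\zeta$, where $E_{\underline a}\boldsymbol\zeta$ is the coloring with $p_a$ increased by $1$ such that $j\in\operatorname{Im}(E_{\underline a}\boldsymbol\zeta)_b$ iff $j=\zeta_b(i)$ with $\pi_b(i)$ before or equal to $\underline a$, or $j=1+\zeta_b(i)$ with $\pi_b(i)$ after or equal to $\underline a$. OPERATIONS. For $Q\in\mathsf{Quilt}(n)$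 and $f_a\in C^{p_a,q_a}(\mathcal A,\mathcal A)$, $\widehat Q(f_1,\dots,f_n)=\sum_{\boldsymbol\zeta\in\mathrm{Clr}(W_Q;\mathbf p)}\sum_{I\in\mathrm{Clr}(T_Q;\mathbf q)}\operatorname{sgn}_Q(\boldsymbol\zeta,I)\,\mathcal L(\boldsymbol\zeta,I;f_1,\dots,f_n)\in C^{p',q'}(\mathcal A,\mathcal A)$, extended multilinearly. *)

theory Defs
  imports
    "HOL-Library.FuncSet"
    "HOL-Library.Sublist"
    "HOL-Combinatorics.Permutations"
    "HOL-Algebra.Module"
begin

section \<open>Trees, words and quilts\<close>

record 'a otree =
  verts :: "'a set"
  edges :: "('a \<times> 'a) set"
  hle :: "('a \<times> 'a) set"

definition vle :: "'a otree \<Rightarrow> ('a \<times> 'a) set"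
  where "vle T = (edges T)\<^sup>* \<inter> verts T \<times> verts T"

definition vless :: "'a otree \<Rightarrow> 'a \<Rightarrow> 'a \<Rightarrow> bool"
  where "vless T u v \<longleftrightarrow> (u, v) \<in> vle T \<and> u \<noteq> v"

definition hless :: "'a otree \<Rightarrow> 'a \<Rightarrow> 'a \<Rightarrow> bool"
  where "hless T u v \<longleftrightarrow> (u, v) \<in> hle T \<and> u \<noteq> v"

definition is_root :: "'a otree \<Rightarrow> 'a \<Rightarrow> bool"
  where "is_root T r \<longleftrightarrow> r \<in> verts T \<and> (\<forall>u. \<not> vless T u r)"

definition exactly_one :: "bool list \<Rightarrow> bool"
  where "exactly_one Ps \<longleftrightarrow> (\<exists>!i. i < length Ps \<and> Ps ! i)"

definition is_tree :: "'a otree \<Rightarrow> bool" where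
  "is_tree T \<longleftrightarrow>
     finite (verts T) \<and>
     edges T \<subseteq> verts T \<times> verts T \<and>
     partial_order_on (verts T) (hle T) \<and>
     (\<forall>u. (u, u) \<notin> edges T) \<and>
     partial_order_on (verts T) (vle T) \<and>
     (\<forall>u v. (u, v) \<in> edges T \<longrightarrow> vless T u v) \<and>
     (\<exists>!r. is_root T r) \<and>
     (\<forall>u v. (u, v) \<in> edges T \<longrightarrow> \<not> (\<exists>t. vless T u t \<and> vless T t v)) \<and>
     (\<forall>u\<in>verts T. \<forall>v\<in>verts T.
        exactly_one [u = v, vless T u v, vless T v u, hless T u v, hless T v u]) \<and>
     (\<forall>u v u' v'. hless T u v \<longrightarrow> (u, u') \<in> vle T \<longrightarrow> (v, v') \<in> vle T \<longrightarrow> hless T u' v')"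

definition Tree :: "nat \<Rightarrow> nat otree set"
  where "Tree n = {T. is_tree T \<and> verts T = {1..n}}"

definition F2S :: "nat \<Rightarrow> nat list set" where
  "F2S n = {W. set W = {1..n} \<and> distinct_adj W \<and>
               (\<forall>u v. u \<noteq> v \<longrightarrow> \<not> subseq [u, v, u, v] W)}"

definition word_deg :: "nat \<Rightarrow> nat list \<Rightarrow> nat"
  where "word_deg n W = length W - n"

definition Quilt :: "nat \<Rightarrow> (nat list \<times> nat otree) set" where
  "Quilt n = {(W, T). W \<in> F2S n \<and> T \<in> Tree n \<and>
     (\<forall>i j. i < j \<longrightarrow> j < length W \<longrightarrow> \<not> vless T (W ! j) (W ! i)) \<and>
     (\<forall>i j k. i < j \<longrightarrow> j < k \<longrightarrow> k < length W \<longrightarrow> W ! i = W ! k \<longrightarrow> (W ! j, W ! i) \<in> hle T)}"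

definition interposed :: "nat list \<Rightarrow> nat \<Rightarrow> bool" where
  "interposed W v \<longleftrightarrow>
     (\<exists>i j. Suc i < j \<and> j < length W \<and> W ! Suc i = v \<and> W ! j = W ! i)"

text \<open>The planar rose tree underlying a tree. The first argument of \<open>unfold_tree\<close> bounds the
  recursion depth; the number of vertices is always a sufficient bound.\<close>

datatype rose = Vertex (label: nat) "rose list"

definition child_list :: "nat otree \<Rightarrow> nat \<Rightarrow> nat list" where
  "child_list T v = (THE cs. set cs = {c. (v, c) \<in> edges T} \<and> sorted_wrt (hless T) cs)"

fun unfold_tree :: "nat \<Rightarrow> nat otree \<Rightarrow> nat \<Rightarrow> rose" where
  "unfold_tree 0 T v = Vertex v []"
| "unfold_tree (Suc k) T v = Vertex v (map (unfold_tree k T) (child_list T v))"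

definition rose_of :: "nat otree \<Rightarrow> rose"
  where "rose_of T = unfold_tree (card (verts T)) T (THE r. is_root T r)"

fun corner_word :: "rose \<Rightarrow> nat list" where
  "corner_word (Vertex v ts) = v # concat (map (\<lambda>t. corner_word t @ [v]) ts)"


section \<open>Colorings\<close>

definition tree_colorings :: "nat otree \<Rightarrow> (nat \<Rightarrow> nat) \<Rightarrow> (nat \<times> nat \<Rightarrow> nat) set" where
  "tree_colorings T q = {I \<in> (\<Pi>\<^sub>E (u, v)\<in>edges T. {1..q u}).
     \<forall>t u v. (t, u) \<in> edges T \<longrightarrow> (t, v) \<in> edges T \<longrightarrow> hless T u v \<longrightarrow> I (t, u) < I (t, v)}"

text \<open>Occurrences in \<open>W\<close> are positions \<open>k < length W\<close> (counted from \<open>0\<close>). For an occurrence \<open>k\<close>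
  of \<open>a = W ! k\<close>, \<open>occ_block W p \<zeta> \<pi> k\<close> is the set of values of \<open>\<zeta> a\<close> on the fibre of \<open>\<pi> a\<close>
  over \<open>k\<close>.\<close>

definition occ_block ::
    "nat list \<Rightarrow> (nat \<Rightarrow> nat) \<Rightarrow> (nat \<Rightarrow> nat \<Rightarrow> nat) \<Rightarrow> (nat \<Rightarrow> nat \<Rightarrow> nat) \<Rightarrow> nat \<Rightarrow> nat set" where
  "occ_block W p \<zeta> \<pi> k = \<zeta> (W ! k) ` {i \<in> {0..p (W ! k)}. \<pi> (W ! k) i = k}"

definition occ_maps ::
    "nat \<Rightarrow> nat list \<Rightarrow> (nat \<Rightarrow> nat) \<Rightarrow> (nat \<Rightarrow> nat \<Rightarrow> nat) \<Rightarrow> (nat \<Rightarrow> nat \<Rightarrow> nat) set" where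
  "occ_maps n W p \<zeta> = {\<pi> \<in> (\<Pi>\<^sub>E a\<in>{1..n}. {0..p a} \<rightarrow>\<^sub>E {..<length W}).
     (\<forall>a\<in>{1..n}. \<pi> a ` {0..p a} = {k. k < length W \<and> W ! k = a}) \<and>
     (\<forall>k<length W. \<exists>l m. occ_block W p \<zeta> \<pi> k = {l..m}) \<and>
     (\<forall>k. Suc k < length W \<longrightarrow>
        Max (occ_block W p \<zeta> \<pi> k) = Min (occ_block W p \<zeta> \<pi> (Suc k)))}"

text \<open>The truncated subtraction is harmless: \<open>word_colorings\<close> is empty when the integer
  \<open>(\<Sum>a. p a) - deg W\<close> is negative.\<close>

definition out_p :: "nat \<Rightarrow> nat list \<Rightarrow> (nat \<Rightarrow> nat) \<Rightarrow> nat"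
  where "out_p n W p = (\<Sum>a\<in>{1..n}. p a) - word_deg n W"

definition word_colorings :: "nat \<Rightarrow> nat list \<Rightarrow> (nat \<Rightarrow> nat) \<Rightarrow> (nat \<Rightarrow> nat \<Rightarrow> nat) set" where
  "word_colorings n W p = {\<zeta> \<in> (\<Pi>\<^sub>E a\<in>{1..n}. {0..p a} \<rightarrow>\<^sub>E {0..out_p n W p}).
     word_deg n W \<le> (\<Sum>a\<in>{1..n}. p a) \<and>
     (\<forall>a\<in>{1..n}. strict_mono_on {0..p a} (\<zeta> a)) \<and>
     (\<Union>a\<in>{1..n}. \<zeta> a ` {0..p a}) = {0..out_p n W p} \<and>
     occ_maps n W p \<zeta> \<noteq> {}}"


section \<open>Signs\<close>

text \<open>\<open>Va a i\<close> and \<open>Ha a i\<close> are the letters \<open>i\<^bsub>va\<^esub>\<close> and \<open>i\<^bsub>ha\<^esub>\<close>.\<close>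

datatype letter = Va nat nat | Ha nat nat

definition initial_word :: "nat \<Rightarrow> (nat \<Rightarrow> nat) \<Rightarrow> (nat \<Rightarrow> nat) \<Rightarrow> letter list" where
  "initial_word n p q = concat (map (\<lambda>a. map (Va a) [0..<p a] @ map (Ha a) [1..<q a]) [1..<Suc n])"

text \<open>\<open>remdups\<close> keeps last occurrences, so \<open>remdups (rev W)\<close> lists the vertices in the reverse of
  their order of first occurrence in \<open>W\<close>.\<close>

definition interposed_part :: "nat list \<Rightarrow> letter list" where
  "interposed_part W = map (\<lambda>a. Va a 0) (filter (interposed W) (remdups (rev W)))"

definition vertical_part ::
    "nat \<Rightarrow> nat list \<Rightarrow> (nat \<Rightarrow> nat) \<Rightarrow> (nat \<Rightarrow> nat \<Rightarrow> nat) \<Rightarrow> letter list" where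
  "vertical_part n W p \<zeta> =
     map (\<lambda>j. THE l. \<exists>a\<in>{1..n}. \<exists>i<p a. l = Va a i \<and> \<zeta> a i = j \<and> (interposed W a \<longrightarrow> 1 \<le> i))
       [0..<out_p n W p]"

text \<open>In \<open>fill_corners I q u w\<close>, \<open>u a\<close> is the number of horizontal letters of \<open>a\<close> already used.\<close>

fun fill_corners ::
    "(nat \<times> nat \<Rightarrow> nat) \<Rightarrow> (nat \<Rightarrow> nat) \<Rightarrow> (nat \<Rightarrow> nat) \<Rightarrow> nat list \<Rightarrow> letter list" where
  "fill_corners I q u [] = []"
| "fill_corners I q u (a # w) =
     (let m = (if a \<in> set w then I (a, hd w) - 1 else q a - 1)
      in map (Ha a) [Suc (u a)..<Suc m] @ fill_corners I q (u(a := m)) w)"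

definition shuffled_word ::
    "nat \<Rightarrow> nat list \<Rightarrow> nat otree \<Rightarrow> (nat \<Rightarrow> nat) \<Rightarrow> (nat \<Rightarrow> nat) \<Rightarrow> (nat \<Rightarrow> nat \<Rightarrow> nat) \<Rightarrow>
     (nat \<times> nat \<Rightarrow> nat) \<Rightarrow> letter list" where
  "shuffled_word n W T p q \<zeta> I =
     interposed_part W @ vertical_part n W p \<zeta> @ fill_corners I q (\<lambda>_. 0) (corner_word (rose_of T))"

definition word_sign :: "'a list \<Rightarrow> 'a list \<Rightarrow> int" where
  "word_sign w w' = sign (THE \<sigma>. \<sigma> permutes {..<length w} \<and> permute_list \<sigma> w = w')"

text \<open>The operator \<open>E\<close> at the occurrence \<open>k\<close>, acting on pairs \<open>(p, \<zeta>)\<close>.\<close>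

definition extend_at ::
    "nat \<Rightarrow> nat list \<Rightarrow> nat \<Rightarrow> (nat \<Rightarrow> nat) \<times> (nat \<Rightarrow> nat \<Rightarrow> nat) \<Rightarrow>
     (nat \<Rightarrow> nat) \<times> (nat \<Rightarrow> nat \<Rightarrow> nat)" where
  "extend_at n W k = (\<lambda>(p, \<zeta>).
     let a = W ! k;
         \<pi> = (THE \<pi>. \<pi> \<in> occ_maps n W p \<zeta>);
         p' = p(a := Suc (p a))
     in (p', \<lambda>b\<in>{1..n}. \<lambda>i\<in>{0..p' b}.
           sorted_list_of_set
             ({\<zeta> b h |h. h \<le> p b \<and> \<pi> b h \<le> k} \<union> {1 + \<zeta> b h |h. h \<le> p b \<and> k \<le> \<pi> b h}) ! i))"

definition extend_vertex ::
    "nat \<Rightarrow> nat list \<Rightarrow> nat \<Rightarrow> (nat \<Rightarrow> nat) \<times> (nat \<Rightarrow> nat \<Rightarrow> nat) \<Rightarrow>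
     (nat \<Rightarrow> nat) \<times> (nat \<Rightarrow> nat \<Rightarrow> nat)" where
  "extend_vertex n W a = (let k = (THE k. k < length W \<and> W ! k = a)
                          in extend_at n W k \<circ> extend_at n W k)"

text \<open>When \<open>p a \<ge> 1\<close> for all interposed \<open>a\<close> and \<open>q a \<ge> 1\<close> for all \<open>a\<close>, the two replacements do
  nothing.\<close>

definition quilt_sgn ::
    "nat \<Rightarrow> nat list \<times> nat otree \<Rightarrow> (nat \<Rightarrow> nat) \<Rightarrow> (nat \<Rightarrow> nat) \<Rightarrow> (nat \<Rightarrow> nat \<Rightarrow> nat) \<Rightarrow>
     (nat \<times> nat \<Rightarrow> nat) \<Rightarrow> int" where
  "quilt_sgn n Q p q \<zeta> I =
     (let W = fst Q; T = snd Q;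
          q2 = (\<lambda>a. if q a = 0 then 2 else q a);
          (p2, \<zeta>2) = fold (extend_vertex n W)
                       (filter (\<lambda>a. interposed W a \<and> p a = 0) [1..<Suc n]) (p, \<zeta>)
      in word_sign (initial_word n p2 q2) (shuffled_word n W T p2 q2 \<zeta>2 I))"


section \<open>Small categories and strings of morphisms\<close>

record ('o, 'm) cat =
  Obj :: "'o set"
  Arr :: "'m set"
  Dom :: "'m \<Rightarrow> 'o"
  Cod :: "'m \<Rightarrow> 'o"
  Ident :: "'o \<Rightarrow> 'm"
  Comp :: "'m \<Rightarrow> 'm \<Rightarrow> 'm"

text \<open>\<open>Comp C g f\<close> is \<open>g \<circ> f\<close>.\<close>

locale small_category =
  fixes C :: "('o, 'm) cat"
  assumes Dom_closed: "f \<in> Arr C \<Longrightarrow> Dom C f \<in> Obj C"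
    and Cod_closed: "f \<in> Arr C \<Longrightarrow> Cod C f \<in> Obj C"
    and Ident_closed: "x \<in> Obj C \<Longrightarrow> Ident C x \<in> Arr C"
    and Dom_Ident: "x \<in> Obj C \<Longrightarrow> Dom C (Ident C x) = x"
    and Cod_Ident: "x \<in> Obj C \<Longrightarrow> Cod C (Ident C x) = x"
    and Comp_closed: "f \<in> Arr C \<Longrightarrow> g \<in> Arr C \<Longrightarrow> Dom C g = Cod C f \<Longrightarrow> Comp C g f \<in> Arr C"
    and Dom_Comp: "f \<in> Arr C \<Longrightarrow> g \<in> Arr C \<Longrightarrow> Dom C g = Cod C f \<Longrightarrow> Dom C (Comp C g f) = Dom C f"
    and Cod_Comp: "f \<in> Arr C \<Longrightarrow> g \<in> Arr C \<Longrightarrow> Dom C g = Cod C f \<Longrightarrow> Cod C (Comp C g f) = Cod C g"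
    and Comp_Ident_right: "f \<in> Arr C \<Longrightarrow> Comp C f (Ident C (Dom C f)) = f"
    and Comp_Ident_left: "f \<in> Arr C \<Longrightarrow> Comp C (Ident C (Cod C f)) f = f"
    and Comp_assoc: "f \<in> Arr C \<Longrightarrow> g \<in> Arr C \<Longrightarrow> h \<in> Arr C \<Longrightarrow>
      Dom C g = Cod C f \<Longrightarrow> Dom C h = Cod C g \<Longrightarrow>
      Comp C (Comp C h g) f = Comp C h (Comp C g f)"

text \<open>A string \<open>x\<^sub>0 \<leftarrow> x\<^sub>1 \<leftarrow> \<dots> \<leftarrow> x\<^sub>p\<close> with arrows \<open>\<phi>\<^sub>1, \<dots>, \<phi>\<^sub>p\<close> is
  the pair \<open>(x\<^sub>0, [\<phi>\<^sub>1, \<dots>, \<phi>\<^sub>p])\<close>, so that \<open>\<phi>\<^sub>i\<close> is \<open>snd \<phi> ! (i - 1)\<close>; for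
  \<open>p = 0\<close> it is just an object.\<close>

definition string_obj :: "('o, 'm) cat \<Rightarrow> 'o \<times> 'm list \<Rightarrow> nat \<Rightarrow> 'o"
  where "string_obj C \<phi> i = (case i of 0 \<Rightarrow> fst \<phi> | Suc j \<Rightarrow> Dom C (snd \<phi> ! j))"

definition strings :: "('o, 'm) cat \<Rightarrow> nat \<Rightarrow> ('o \<times> 'm list) set" where
  "strings C p = {\<phi>. fst \<phi> \<in> Obj C \<and> length (snd \<phi>) = p \<and>
     (\<forall>i<p. snd \<phi> ! i \<in> Arr C \<and> Cod C (snd \<phi> ! i) = string_obj C \<phi> i)}"

text \<open>\<open>string_arr C \<phi> k l\<close> is \<open>\<phi>\<^bsub>k,l\<^esub> = \<phi>\<^bsub>k+1\<^esub> \<circ> \<dots> \<circ> \<phi>\<^bsub>l\<^esub> : x\<^sub>l \<rightarrow> x\<^sub>k\<close>,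
  for \<open>k \<le> l\<close>.\<close>

definition string_arr :: "('o, 'm) cat \<Rightarrow> 'o \<times> 'm list \<Rightarrow> nat \<Rightarrow> nat \<Rightarrow> 'm" where
  "string_arr C \<phi> k l = foldr (Comp C) (map (\<lambda>j. snd \<phi> ! j) [k..<l]) (Ident C (string_obj C \<phi> l))"

definition pull :: "('o, 'm) cat \<Rightarrow> nat \<Rightarrow> (nat \<Rightarrow> nat) \<Rightarrow> 'o \<times> 'm list \<Rightarrow> 'o \<times> 'm list" where
  "pull C p \<zeta> \<phi> =
     (string_obj C \<phi> (\<zeta> 0), map (\<lambda>i. string_arr C \<phi> (\<zeta> i) (\<zeta> (Suc i))) [0..<p])"

definition coface :: "nat \<Rightarrow> nat \<Rightarrow> nat"
  where "coface i j = (if j < i then j else Suc j)"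


section \<open>Multilinear maps\<close>

definition linear_maps :: "'k ring \<Rightarrow> ('k, 'v) module \<Rightarrow> ('k, 'v) module \<Rightarrow> ('v \<Rightarrow> 'v) set" where
  "linear_maps K X Y = {g \<in> carrier X \<rightarrow> carrier Y.
     (\<forall>u\<in>carrier X. \<forall>v\<in>carrier X. g (u \<oplus>\<^bsub>X\<^esub> v) = g u \<oplus>\<^bsub>Y\<^esub> g v) \<and>
     (\<forall>c\<in>carrier K. \<forall>u\<in>carrier X. g (c \<odot>\<^bsub>X\<^esub> u) = c \<odot>\<^bsub>Y\<^esub> g u)}"

definition tuples :: "nat \<Rightarrow> ('k, 'v) module \<Rightarrow> 'v list set"
  where "tuples q X = {vs. length vs = q \<and> set vs \<subseteq> carrier X}"

text \<open>Linear maps \<open>X\<^sup>\<otimes>\<^sup>q \<rightarrow> Y\<close> are represented by \<open>q\<close>-linear maps, given on lists of length \<open>q\<close>.\<close>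

definition multilinear_maps ::
    "'k ring \<Rightarrow> nat \<Rightarrow> ('k, 'v) module \<Rightarrow> ('k, 'v) module \<Rightarrow> ('v list \<Rightarrow> 'v) set" where
  "multilinear_maps K q X Y = {g \<in> tuples q X \<rightarrow>\<^sub>E carrier Y.
     \<forall>vs\<in>tuples q X. \<forall>i<q. (\<lambda>u. g (vs[i := u])) \<in> linear_maps K X Y}"

text \<open>\<open>fill_inputs sub g slots vs\<close> computes the arguments for the listed input slots: a slot \<open>i\<close> with
  \<open>sub i = Some (m, h)\<close> consumes the next \<open>m\<close> vectors of \<open>vs\<close> and feeds them to \<open>h\<close>; any other slot
  consumes one vector and applies \<open>g\<close> to it.\<close>

fun fill_inputs ::
    "(nat \<Rightarrow> (nat \<times> ('v list \<Rightarrow> 'v)) option) \<Rightarrow> ('v \<Rightarrow> 'v) \<Rightarrow> nat list \<Rightarrow> 'v list \<Rightarrow> 'v list" where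
  "fill_inputs sub g [] vs = []"
| "fill_inputs sub g (i # is) vs =
     (case sub i of
        None \<Rightarrow> g (hd vs) # fill_inputs sub g is (tl vs)
      | Some (m, h) \<Rightarrow> h (take m vs) # fill_inputs sub g is (drop m vs))"

text \<open>The number of inputs of the composite along a rose tree.\<close>

fun num_inputs :: "(nat \<Rightarrow> nat) \<Rightarrow> rose \<Rightarrow> nat" where
  "num_inputs q (Vertex a ts) = (q a - length ts) + (\<Sum>t\<leftarrow>ts. num_inputs q t)"


section \<open>Cochains and the operations of quilts\<close>

type_synonym ('o, 'm, 'v) cochain = "'o \<times> 'm list \<Rightarrow> 'v list \<Rightarrow> 'v"

text \<open>A family of cochains, one in each bidegree.\<close>

type_synonym ('o, 'm, 'v) cochains = "nat \<Rightarrow> nat \<Rightarrow> ('o, 'm, 'v) cochain"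

locale vec_functor = small_category C + K: field K
  for C :: "('o, 'm) cat" and K :: "'k ring" +
  fixes V :: "'o \<Rightarrow> ('k, 'v) module"
    and A :: "'m \<Rightarrow> 'v \<Rightarrow> 'v"
  assumes V_module: "x \<in> Obj C \<Longrightarrow> module K (V x)"
    and A_linear: "f \<in> Arr C \<Longrightarrow> A f \<in> linear_maps K (V (Dom C f)) (V (Cod C f))"
    and A_Ident: "x \<in> Obj C \<Longrightarrow> v \<in> carrier (V x) \<Longrightarrow> A (Ident C x) v = v"
    and A_Comp: "f \<in> Arr C \<Longrightarrow> g \<in> Arr C \<Longrightarrow> Dom C g = Cod C f \<Longrightarrow>
      v \<in> carrier (V (Dom C f)) \<Longrightarrow> A (Comp C g f) v = A g (A f v)"
begin

definition src :: "'o \<times> 'm list \<Rightarrow> ('k, 'v) module"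
  where "src \<phi> = V (string_obj C \<phi> (length (snd \<phi>)))"

definition tgt :: "'o \<times> 'm list \<Rightarrow> ('k, 'v) module"
  where "tgt \<phi> = V (string_obj C \<phi> 0)"

definition cochains :: "nat \<Rightarrow> nat \<Rightarrow> ('o, 'm, 'v) cochain set"
  where "cochains p q = (\<Pi>\<^sub>E \<phi>\<in>strings C p. multilinear_maps K q (src \<phi>) (tgt \<phi>))"

definition zero_cochain :: "nat \<Rightarrow> nat \<Rightarrow> ('o, 'm, 'v) cochain"
  where "zero_cochain p q = (\<lambda>\<phi>\<in>strings C p. \<lambda>vs\<in>tuples q (src \<phi>). \<zero>\<^bsub>tgt \<phi>\<^esub>)"

definition reduced_cochains :: "nat \<Rightarrow> nat \<Rightarrow> ('o, 'm, 'v) cochain set" where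
  "reduced_cochains p q = {f \<in> cochains p q.
     \<forall>\<phi>\<in>strings C p. (\<exists>x\<in>Obj C. Ident C x \<in> set (snd \<phi>)) \<longrightarrow>
       f \<phi> = (\<lambda>vs\<in>tuples q (src \<phi>). \<zero>\<^bsub>tgt \<phi>\<^esub>)}"

definition delta_S :: "nat \<Rightarrow> nat \<Rightarrow> ('o, 'm, 'v) cochain \<Rightarrow> ('o, 'm, 'v) cochain" where
  "delta_S p q f = (\<lambda>\<phi>\<in>strings C (Suc p). \<lambda>vs\<in>tuples q (src \<phi>).
     \<Oplus>\<^bsub>tgt \<phi>\<^esub>i\<in>{0..Suc p}. [((-1) ^ i :: int)] \<cdot>\<^bsub>tgt \<phi>\<^esub>
       A (string_arr C \<phi> 0 (coface i 0))
         (f (pull C p (coface i) \<phi>) (map (A (string_arr C \<phi> (coface i p) (Suc p))) vs)))"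

text \<open>\<open>compose_rose p \<zeta> I q f \<phi> t\<close> composes the maps \<open>f\<^sub>a[\<zeta>\<^sub>a\<^sup>* \<phi>]\<close> along the rose tree \<open>t\<close>, without the
  final map into \<open>tgt \<phi>\<close>.\<close>

fun compose_rose ::
    "(nat \<Rightarrow> nat) \<Rightarrow> (nat \<Rightarrow> nat) \<Rightarrow> (nat \<Rightarrow> nat \<Rightarrow> nat) \<Rightarrow> (nat \<times> nat \<Rightarrow> nat) \<Rightarrow>
     (nat \<Rightarrow> ('o, 'm, 'v) cochain) \<Rightarrow> 'o \<times> 'm list \<Rightarrow> rose \<Rightarrow> 'v list \<Rightarrow> 'v" where
  "compose_rose p q \<zeta> I f \<phi> (Vertex a ts) vs =
     f a (pull C (p a) (\<zeta> a) \<phi>)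
       (fill_inputs
         (map_of (map (\<lambda>t. (I (a, label t),
            (num_inputs q t,
             \<lambda>ws. A (string_arr C \<phi> (\<zeta> a (p a)) (\<zeta> (label t) 0))
                    (compose_rose p q \<zeta> I f \<phi> t ws)))) ts))
         (A (string_arr C \<phi> (\<zeta> a (p a)) (length (snd \<phi>))))
         [1..<Suc (q a)] vs)"

definition coloring_action ::
    "nat otree \<Rightarrow> (nat \<Rightarrow> nat) \<Rightarrow> (nat \<Rightarrow> nat) \<Rightarrow> (nat \<Rightarrow> nat \<Rightarrow> nat) \<Rightarrow> (nat \<times> nat \<Rightarrow> nat) \<Rightarrow>
     (nat \<Rightarrow> ('o, 'm, 'v) cochain) \<Rightarrow> ('o, 'm, 'v) cochain" where
  "coloring_action T p q \<zeta> I f \<phi> vs =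
     A (string_arr C \<phi> 0 (\<zeta> (label (rose_of T)) 0)) (compose_rose p q \<zeta> I f \<phi> (rose_of T) vs)"

text \<open>The horizontal output degree is \<open>1 + (\<Sum>a. q a - 1)\<close>; it can only be negative if
  \<open>tree_colorings (snd Q) q\<close> is empty.\<close>

definition out_q :: "nat \<Rightarrow> (nat \<Rightarrow> nat) \<Rightarrow> int"
  where "out_q n q = 1 + (\<Sum>a\<in>{1..n}. int (q a) - 1)"

definition quilt_op ::
    "nat \<Rightarrow> nat list \<times> nat otree \<Rightarrow> (nat \<Rightarrow> nat) \<Rightarrow> (nat \<Rightarrow> nat) \<Rightarrow>
     (nat \<Rightarrow> ('o, 'm, 'v) cochain) \<Rightarrow> ('o, 'm, 'v) cochain" where
  "quilt_op n Q p q f =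
     (\<lambda>\<phi>\<in>strings C (out_p n (fst Q) p). \<lambda>vs\<in>tuples (nat (out_q n q)) (src \<phi>).
        \<Oplus>\<^bsub>tgt \<phi>\<^esub>\<zeta>\<in>word_colorings n (fst Q) p. \<Oplus>\<^bsub>tgt \<phi>\<^esub>I\<in>tree_colorings (snd Q) q.
          [quilt_sgn n Q p q \<zeta> I] \<cdot>\<^bsub>tgt \<phi>\<^esub> coloring_action (snd Q) p q \<zeta> I f \<phi> vs)"

text \<open>The bigraded space \<open>C\<^sup>\<bullet>\<^sup>\<bullet>\<close>, as the direct sum of its components: families of cochains that
  are zero in almost all bidegrees. The multiplicative fields of the record are not used.\<close>

definition total_module :: "('k, ('o, 'm, 'v) cochains) module" where
  "total_module = \<lparr>
     carrier = {F. (\<forall>p q. F p q \<in> cochains p q) \<and> finite {(p, q). F p q \<noteq> zero_cochain p q}},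
     mult = undefined,
     one = undefined,
     zero = zero_cochain,
     add = (\<lambda>F G p q. \<lambda>\<phi>\<in>strings C p. \<lambda>vs\<in>tuples q (src \<phi>). F p q \<phi> vs \<oplus>\<^bsub>tgt \<phi>\<^esub> G p q \<phi> vs),
     smult = (\<lambda>c F p q. \<lambda>\<phi>\<in>strings C p. \<lambda>vs\<in>tuples q (src \<phi>). c \<odot>\<^bsub>tgt \<phi>\<^esub> F p q \<phi> vs)\<rparr>"

definition total_reduced :: "('o, 'm, 'v) cochains set" where
  "total_reduced = {F \<in> carrier total_module. \<forall>p q. F p q \<in> reduced_cochains p q}"

definition total_delta_S :: "('o, 'm, 'v) cochains \<Rightarrow> ('o, 'm, 'v) cochains" where
  "total_delta_S F p q =
     (case p of 0 \<Rightarrow> zero_cochain 0 q | Suc p' \<Rightarrow> delta_S p' q (F p' q))"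

text \<open>The multilinear extension of \<open>quilt_op\<close>. Its component in bidegree \<open>(P, R)\<close> is a sum over the
  choices, for each \<open>a\<close>, of a nonzero homogeneous component \<open>F a (p a) (q a)\<close> of \<open>F a\<close>, subject to
  the output having bidegree \<open>(P, R)\<close>.\<close>

definition op_bidegrees ::
    "nat \<Rightarrow> nat list \<times> nat otree \<Rightarrow> (nat \<Rightarrow> ('o, 'm, 'v) cochains) \<Rightarrow> nat \<Rightarrow> nat \<Rightarrow>
     ((nat \<Rightarrow> nat) \<times> (nat \<Rightarrow> nat)) set" where
  "op_bidegrees n Q F P R =
     {(p, q) \<in> ({1..n} \<rightarrow>\<^sub>E UNIV) \<times> ({1..n} \<rightarrow>\<^sub>E UNIV).
        (\<forall>a\<in>{1..n}. F a (p a) (q a) \<noteq> zero_cochain (p a) (q a)) \<and>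
        int P = (\<Sum>a\<in>{1..n}. int (p a)) - int (word_deg n (fst Q)) \<and>
        int R = out_q n q}"

definition total_quilt_op ::
    "nat \<Rightarrow> nat list \<times> nat otree \<Rightarrow> (nat \<Rightarrow> ('o, 'm, 'v) cochains) \<Rightarrow> ('o, 'm, 'v) cochains" where
  "total_quilt_op n Q F P R = (\<lambda>\<phi>\<in>strings C P. \<lambda>vs\<in>tuples R (src \<phi>).
     \<Oplus>\<^bsub>tgt \<phi>\<^esub>pq\<in>op_bidegrees n Q F P R.
       quilt_op n Q (fst pq) (snd pq) (\<lambda>a. F a (fst pq a) (snd pq a)) \<phi> vs)"

definition quilt_subalgebra :: "('o, 'm, 'v) cochains set \<Rightarrow> bool" where
  "quilt_subalgebra S \<longleftrightarrow>
     submodule S K total_module \<and>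
     (\<forall>F\<in>S. total_delta_S F \<in> S) \<and>
     (\<forall>n. \<forall>Q\<in>Quilt n. \<forall>F. (\<forall>a\<in>{1..n}. F a \<in> S) \<longrightarrow> total_quilt_op n Q F \<in> S)"

end

end

(* A normalised cochain kills every string containing an identity arrow, so it suffices to find, for
   each coloring, a vertex a whose pulled back string contains the identity at step j -> j + 1 of the
   given string. The occurrence blocks of a coloring are intervals, consecutive ones overlapping in
   one point, so both j and j + 1 lie in a single block, hence in the image of a single zeta_a. Thus
   every summand of a quilt operation vanishes separately, whatever its sign. In the simplicial
   differential only the two faces at j and j + 1 survive, and these cancel. *)

theory Submission
  imports Defs
begin

section \<open>Multilinear maps\<close>

text \<open>Vanishing on degenerate strings is only part of what has to be shown: a reduced cochain
  is first of all a cochain, so every result must be multilinear, and the total space also asks for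
  finite support. The analysis of how an input travels through a composite serves both purposes. A
  zero fed into one slot of a multilinear map gives zero, so a single vanishing vertex kills the
  composite all the way to the root.

  Two encodings have to be matched. Trees and their colorings speak of vertices, edges and orders,
  whereas the composite is a recursion on a planar rose tree that consumes a list of vectors. The
  bridge is that the unfolding lists every vertex exactly once and that the number of inputs counted
  along it is \<open>out_q\<close>.

  An identity arrow is sure to survive as a component of a pulled back string when its two ends are
  consecutive values of \<open>\<zeta> a\<close>; otherwise it may be absorbed into a longer
  composite. For the differential, the two exceptional faces agree even when one of them is an end
  face, because the outer maps, like the pulled back string, see positions only up to identifying
  \<open>j\<close> with \<open>j + 1\<close>.\<close>

definition multilinear :: "'k ring \<Rightarrow> nat \<Rightarrow> ('k, 'v) module \<Rightarrow> ('k, 'v) module \<Rightarrow> ('v list \<Rightarrow> 'v) \<Rightarrow> bool"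
  where "multilinear K q X Y g \<longleftrightarrow> g \<in> tuples q X \<rightarrow> carrier Y \<and>
    (\<forall>vs\<in>tuples q X. \<forall>i<q. (\<lambda>u. g (vs[i := u])) \<in> linear_maps K X Y)"

lemma tuples_update: "vs \<in> tuples q X \<Longrightarrow> u \<in> carrier X \<Longrightarrow> vs[i := u] \<in> tuples q X"
  unfolding tuples_def using set_update_subset_insert by fastforce

lemma linear_maps_cong:
  assumes "module K X" "\<And>u. u \<in> carrier X \<Longrightarrow> g u = h u"
  shows "g \<in> linear_maps K X Y \<longleftrightarrow> h \<in> linear_maps K X Y"
proof -
  interpret X: module K X by fact
  show ?thesis unfolding linear_maps_def using assms(2) by (auto simp: Pi_iff)
qed

lemma multilinear_cong:
  assumes "module K X" "\<And>vs. vs \<in> tuples q X \<Longrightarrow> g vs = h vs"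
  shows "multilinear K q X Y g \<longleftrightarrow> multilinear K q X Y h"
proof -
  have "(\<lambda>u. g (vs[i := u])) \<in> linear_maps K X Y \<longleftrightarrow> (\<lambda>u. h (vs[i := u])) \<in> linear_maps K X Y"
    if "vs \<in> tuples q X" for vs i
    by (rule linear_maps_cong) (use assms tuples_update[OF that] in auto)
  then show ?thesis unfolding multilinear_def using assms(2) by (auto simp: Pi_iff)
qed

text \<open>Extensionality is split off because sums and composites are built as plain functions on
  lists; they become extensional only through the restriction in the outermost definition.\<close>

lemma multilinear_maps_iff:
  "g \<in> multilinear_maps K q X Y \<longleftrightarrow> g \<in> extensional (tuples q X) \<and> multilinear K q X Y g"
  by (auto simp: multilinear_maps_def multilinear_def PiE_def)

lemma restrict_multilinear_maps:
  assumes "module K X" "multilinear K q X Y g"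
  shows "restrict g (tuples q X) \<in> multilinear_maps K q X Y"
  using multilinear_cong[OF assms(1), of q "restrict g (tuples q X)" g Y] assms(2)
  by (simp add: multilinear_maps_iff)

lemma linear_mapsD:
  assumes "g \<in> linear_maps K X Y"
  shows "u \<in> carrier X \<Longrightarrow> g u \<in> carrier Y"
    and "u \<in> carrier X \<Longrightarrow> v \<in> carrier X \<Longrightarrow> g (u \<oplus>\<^bsub>X\<^esub> v) = g u \<oplus>\<^bsub>Y\<^esub> g v"
    and "c \<in> carrier K \<Longrightarrow> u \<in> carrier X \<Longrightarrow> g (c \<odot>\<^bsub>X\<^esub> u) = c \<odot>\<^bsub>Y\<^esub> g u"
  using assms by (auto simp: linear_maps_def)

lemma linear_mapsI:
  assumes "\<And>u. u \<in> carrier X \<Longrightarrow> g u \<in> carrier Y"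
    and "\<And>u v. u \<in> carrier X \<Longrightarrow> v \<in> carrier X \<Longrightarrow> g (u \<oplus>\<^bsub>X\<^esub> v) = g u \<oplus>\<^bsub>Y\<^esub> g v"
    and "\<And>c u. c \<in> carrier K \<Longrightarrow> u \<in> carrier X \<Longrightarrow> g (c \<odot>\<^bsub>X\<^esub> u) = c \<odot>\<^bsub>Y\<^esub> g u"
  shows "g \<in> linear_maps K X Y"
  using assms by (auto simp: linear_maps_def)

lemma linear_maps_comp:
  "g \<in> linear_maps K X Y \<Longrightarrow> h \<in> linear_maps K Y Z \<Longrightarrow> (\<lambda>u. h (g u)) \<in> linear_maps K X Z"
  by (auto simp: linear_maps_def Pi_iff)

lemma linear_maps_zero:
  assumes "module K X" "module K Y" "g \<in> linear_maps K X Y"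
  shows "g \<zero>\<^bsub>X\<^esub> = \<zero>\<^bsub>Y\<^esub>"
proof -
  interpret X: module K X by fact
  interpret Y: module K Y by fact
  have "g \<zero>\<^bsub>X\<^esub> \<oplus>\<^bsub>Y\<^esub> g \<zero>\<^bsub>X\<^esub> = g \<zero>\<^bsub>X\<^esub>"
    using linear_mapsD(2)[OF assms(3), of "\<zero>\<^bsub>X\<^esub>" "\<zero>\<^bsub>X\<^esub>"] by simp
  then show ?thesis using linear_mapsD(1)[OF assms(3), of "\<zero>\<^bsub>X\<^esub>"]
    by (metis X.M.zero_closed Y.M.add.r_cancel_one')
qed

text \<open>Signs enter the operations as integer multiples in the additive group. They commute with
  scalars because multiplication by \<open>c\<close> is an endomorphism of that group.\<close>

lemma smult_int_pow:
  assumes "module K Y" "c \<in> carrier K" "x \<in> carrier Y"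
  shows "c \<odot>\<^bsub>Y\<^esub> ([(k::int)] \<cdot>\<^bsub>Y\<^esub> x) = [k] \<cdot>\<^bsub>Y\<^esub> (c \<odot>\<^bsub>Y\<^esub> x)"
proof -
  interpret Y: module K Y by fact
  have "(\<lambda>x. c \<odot>\<^bsub>Y\<^esub> x) \<in> hom (add_monoid Y) (add_monoid Y)"
    using assms by (auto simp: hom_def Y.smult_r_distr)
  from hom_int_pow[OF this, of x k] show ?thesis
    using assms Y.M.a_group by (simp add: add_pow_def)
qed

lemma linear_maps_int_pow:
  assumes "module K X" "module K Y" "g \<in> linear_maps K X Y"
  shows "(\<lambda>u. [(k::int)] \<cdot>\<^bsub>Y\<^esub> g u) \<in> linear_maps K X Y"
proof -
  interpret X: module K X by fact
  interpret Y: module K Y by fact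
  note D = linear_mapsD[OF assms(3)]
  show ?thesis
    by (rule linear_mapsI) (auto simp: D smult_int_pow[OF assms(2)] Y.M.add.int_pow_distrib)
qed

lemma linear_maps_finsum:
  assumes "module K X" "module K Y" "\<And>i. i \<in> S \<Longrightarrow> g i \<in> linear_maps K X Y"
  shows "(\<lambda>u. \<Oplus>\<^bsub>Y\<^esub>i\<in>S. g i u) \<in> linear_maps K X Y"
proof -
  interpret X: module K X by fact
  interpret Y: module K Y by fact
  note D = linear_mapsD[OF assms(3)]
  have cl: "u \<in> carrier X \<Longrightarrow> (\<lambda>i. g i u) \<in> S \<rightarrow> carrier Y" for u using D by auto
  show ?thesis
  proof (rule linear_mapsI)
    fix u v assume uv: "u \<in> carrier X" "v \<in> carrier X"
    have "(\<Oplus>\<^bsub>Y\<^esub>i\<in>S. g i (u \<oplus>\<^bsub>X\<^esub> v)) = (\<Oplus>\<^bsub>Y\<^esub>i\<in>S. g i u \<oplus>\<^bsub>Y\<^esub> g i v)"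
      by (rule Y.M.finsum_cong') (use uv D in auto)
    then show "(\<Oplus>\<^bsub>Y\<^esub>i\<in>S. g i (u \<oplus>\<^bsub>X\<^esub> v)) = (\<Oplus>\<^bsub>Y\<^esub>i\<in>S. g i u) \<oplus>\<^bsub>Y\<^esub> (\<Oplus>\<^bsub>Y\<^esub>i\<in>S. g i v)"
      using uv cl Y.M.finsum_addf by simp
  next
    fix c u assume cu: "c \<in> carrier K" "u \<in> carrier X"
    show "(\<Oplus>\<^bsub>Y\<^esub>i\<in>S. g i (c \<odot>\<^bsub>X\<^esub> u)) = c \<odot>\<^bsub>Y\<^esub> (\<Oplus>\<^bsub>Y\<^esub>i\<in>S. g i u)"
    proof (cases "finite S")
      case True
      have "(\<Oplus>\<^bsub>Y\<^esub>i\<in>S. g i (c \<odot>\<^bsub>X\<^esub> u)) = (\<Oplus>\<^bsub>Y\<^esub>i\<in>S. c \<odot>\<^bsub>Y\<^esub> g i u)"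
        by (rule Y.M.finsum_cong') (use cu D in auto)
      then show ?thesis using Y.finsum_smult_ldistr[OF True cu(1) cl[OF cu(2)]] by simp
    next
      \<comment> \<open>\<open>finsum\<close> over an infinite index set is zero by convention, so
        both sides are zero.\<close>
      case False
      then show ?thesis using cu by (simp add: Y.M.finsum_infinite)
    qed
  qed (use cl Y.M.finsum_closed in auto)
qed

lemma multilinear_closed: "multilinear K q X Y g \<Longrightarrow> vs \<in> tuples q X \<Longrightarrow> g vs \<in> carrier Y"
  by (auto simp: multilinear_def)

lemma multilinear_int_pow:
  assumes "module K X" "module K Y" "multilinear K q X Y g"
  shows "multilinear K q X Y (\<lambda>vs. [(k::int)] \<cdot>\<^bsub>Y\<^esub> g vs)"
proof -
  interpret Y: module K Y by fact
  show ?thesis using assms linear_maps_int_pow[OF assms(1,2)]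
    by (auto simp: multilinear_def Pi_iff)
qed

lemma multilinear_finsum:
  assumes "module K X" "module K Y" "\<And>i. i \<in> S \<Longrightarrow> multilinear K q X Y (g i)"
  shows "multilinear K q X Y (\<lambda>vs. \<Oplus>\<^bsub>Y\<^esub>i\<in>S. g i vs)"
proof -
  interpret Y: module K Y by fact
  have "(\<lambda>u. \<Oplus>\<^bsub>Y\<^esub>i\<in>S. g i (vs[j := u])) \<in> linear_maps K X Y" if "vs \<in> tuples q X" "j < q" for vs j
    by (rule linear_maps_finsum) (use assms that in \<open>auto simp: multilinear_def\<close>)
  then show ?thesis using assms(3)
    by (auto simp: multilinear_def Pi_iff intro!: Y.M.finsum_closed)
qed

lemma multilinear_zero:
  assumes "module K X" "module K Y"
  shows "multilinear K q X Y (\<lambda>vs. \<zero>\<^bsub>Y\<^esub>)"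
proof -
  interpret Y: module K Y by fact
  show ?thesis by (auto simp: multilinear_def linear_maps_def)
qed

lemma multilinear_add:
  assumes "module K X" "module K Y" "multilinear K q X Y g" "multilinear K q X Y h"
  shows "multilinear K q X Y (\<lambda>vs. g vs \<oplus>\<^bsub>Y\<^esub> h vs)"
proof -
  interpret X: module K X by fact
  interpret Y: module K Y by fact
  have "(\<lambda>u. a u \<oplus>\<^bsub>Y\<^esub> b u) \<in> linear_maps K X Y"
    if "a \<in> linear_maps K X Y" "b \<in> linear_maps K X Y" for a b
    by (rule linear_mapsI)
      (auto simp: linear_mapsD[OF that(1)] linear_mapsD[OF that(2)] Y.smult_r_distr Y.M.a_ac)
  then show ?thesis using assms(3,4) by (auto simp: multilinear_def Pi_iff)
qed

lemma multilinear_smult: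
  assumes "module K X" "module K Y" "multilinear K q X Y g" "c \<in> carrier K"
  shows "multilinear K q X Y (\<lambda>vs. c \<odot>\<^bsub>Y\<^esub> g vs)"
proof -
  interpret X: module K X by fact
  interpret Y: module K Y by fact
  have "(\<lambda>u. c \<odot>\<^bsub>Y\<^esub> a u) \<in> linear_maps K X Y" if "a \<in> linear_maps K X Y" for a
    using assms(4)
    by (intro linear_mapsI)
      (auto simp: linear_mapsD[OF that] Y.smult_r_distr Y.smult_assoc1[symmetric] X.R.m_comm)
  then show ?thesis using assms(3,4) by (auto simp: multilinear_def Pi_iff)
qed

lemma multilinear_postcomp:
  assumes "multilinear K q X Y g" "h \<in> linear_maps K Y Z"
  shows "multilinear K q X Z (\<lambda>vs. h (g vs))"
  using assms linear_maps_comp[OF _ assms(2)] linear_mapsD(1)[OF assms(2)]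
  by (auto simp: multilinear_def Pi_iff)

text \<open>With all other entries frozen the map is linear in entry \<open>i\<close>, hence sends
  zero to zero. This is how the vanishing of one vertex is passed on to its parent.\<close>

lemma multilinear_zero_entry:
  assumes "module K X" "module K Y" "multilinear K q X Y g" "vs \<in> tuples q X" "i < q" "vs ! i = \<zero>\<^bsub>X\<^esub>"
  shows "g vs = \<zero>\<^bsub>Y\<^esub>"
proof -
  have "(\<lambda>u. g (vs[i := u])) \<in> linear_maps K X Y" using assms by (auto simp: multilinear_def)
  from linear_maps_zero[OF assms(1,2) this] show ?thesis
    using assms(6) by (metis list_update_id)
qed

text \<open>The third hypothesis is the shape of a substitution in which every input is used exactly
  once: changing input \<open>j\<close> changes a single entry of \<open>F vs\<close>, and does so
  linearly. The entry \<open>i\<close> and the map \<open>h\<close> may depend on \<open>vs\<close>,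
  since \<open>h\<close> has the other inputs built in.\<close>

lemma multilinear_precomp:
  assumes "multilinear K q X Y g"
    and "\<And>vs. vs \<in> tuples q' Z \<Longrightarrow> F vs \<in> tuples q X"
    and "\<And>vs j. vs \<in> tuples q' Z \<Longrightarrow> j < q' \<Longrightarrow>
      \<exists>i<q. \<exists>h\<in>linear_maps K Z X. \<forall>u\<in>carrier Z. F (vs[j := u]) = (F vs)[i := h u]"
    and "module K Z"
  shows "multilinear K q' Z Y (\<lambda>vs. g (F vs))"
  unfolding multilinear_def
proof (intro conjI ballI allI impI)
  show "(\<lambda>vs. g (F vs)) \<in> tuples q' Z \<rightarrow> carrier Y"
    using assms(1,2) by (auto simp: multilinear_def)
  fix vs j assume vs: "vs \<in> tuples q' Z" and j: "j < q'"
  obtain i h where i: "i < q" and h: "h \<in> linear_maps K Z X"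
    and eq: "\<And>u. u \<in> carrier Z \<Longrightarrow> F (vs[j := u]) = (F vs)[i := h u]"
    using assms(3)[OF vs j] by blast
  have "(\<lambda>u. g ((F vs)[i := u])) \<in> linear_maps K X Y"
    using assms(1) assms(2)[OF vs] i by (auto simp: multilinear_def)
  from linear_maps_comp[OF h this]
  show "(\<lambda>u. g (F (vs[j := u]))) \<in> linear_maps K Z Y"
    using linear_maps_cong[OF assms(4), of "\<lambda>u. g (F (vs[j := u]))" "\<lambda>u. g ((F vs)[i := h u])"] eq
    by simp
qed

lemma map_tuples: "h \<in> linear_maps K X Y \<Longrightarrow> vs \<in> tuples q X \<Longrightarrow> map h vs \<in> tuples q Y"
  by (auto simp: tuples_def linear_maps_def)

lemma multilinear_map:
  assumes "module K Z" "multilinear K q X Y g" "h \<in> linear_maps K Z X"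
  shows "multilinear K q Z Y (\<lambda>vs. g (map h vs))"
  using assms(2) map_tuples[OF assms(3)]
  by (rule multilinear_precomp) (use assms in \<open>auto simp: map_update\<close>)

section \<open>Substituting multilinear maps into input slots\<close>

definition slot_arity :: "(nat \<Rightarrow> (nat \<times> ('v list \<Rightarrow> 'v)) option) \<Rightarrow> nat \<Rightarrow> nat"
  where "slot_arity sub i = (case sub i of None \<Rightarrow> 1 | Some (m, h) \<Rightarrow> m)"

lemma tuples_split: "vs \<in> tuples (m + l) X \<Longrightarrow> take m vs \<in> tuples m X \<and> drop m vs \<in> tuples l X"
  by (auto simp: tuples_def dest: in_set_takeD in_set_dropD)

lemma fill_inputs_tuples:
  assumes "g \<in> linear_maps K X Y"
    and "\<And>i m h. i \<in> set slots \<Longrightarrow> sub i = Some (m, h) \<Longrightarrow> multilinear K m X Y h"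
    and "vs \<in> tuples (\<Sum>i\<leftarrow>slots. slot_arity sub i) X"
  shows "fill_inputs sub g slots vs \<in> tuples (length slots) Y"
  using assms(2,3)
proof (induction slots arbitrary: vs)
  case Nil
  then show ?case by (simp add: tuples_def)
next
  case (Cons s slots)
  have vs: "take (slot_arity sub s) vs \<in> tuples (slot_arity sub s) X"
    "drop (slot_arity sub s) vs \<in> tuples (\<Sum>i\<leftarrow>slots. slot_arity sub i) X"
    using tuples_split Cons.prems(2) by force+
  have IH: "fill_inputs sub g slots (drop (slot_arity sub s) vs) \<in> tuples (length slots) Y"
    by (rule Cons.IH[OF _ vs(2)]) (rule Cons.prems(1), auto)
  show ?case
  proof (cases "sub s")
    case None
    then obtain v where v: "take (Suc 0) vs = [v]" "v \<in> carrier X"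
      using vs(1) by (auto simp: slot_arity_def tuples_def length_Suc_conv)
    then have "hd vs = v" by (cases vs) auto
    then show ?thesis using None IH v(2) linear_mapsD(1)[OF assms(1)]
      by (auto simp: slot_arity_def tuples_def drop_Suc)
  next
    case (Some mh)
    obtain m h where mh: "mh = (m, h)" by force
    have "h (take m vs) \<in> carrier Y"
      using Cons.prems(1)[of s m h] Some mh vs(1) by (simp add: slot_arity_def multilinear_closed)
    then show ?thesis using Some mh IH by (auto simp: slot_arity_def tuples_def)
  qed
qed

text \<open>The slots cut \<open>vs\<close> into disjoint consecutive pieces, so entry
  \<open>j\<close> reaches exactly one slot. There \<open>h\<close> is \<open>g\<close> if the slot
  is free, and otherwise the substituted map with its remaining inputs frozen. This is the form that
  \<open>multilinear_precomp\<close> asks for.\<close>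

lemma fill_inputs_update:
  assumes "g \<in> linear_maps K X Y"
    and "\<And>i m h. i \<in> set slots \<Longrightarrow> sub i = Some (m, h) \<Longrightarrow> multilinear K m X Y h"
    and "vs \<in> tuples (\<Sum>i\<leftarrow>slots. slot_arity sub i) X" and "j < length vs"
  shows "\<exists>i<length slots. \<exists>h\<in>linear_maps K X Y. \<forall>u\<in>carrier X.
    fill_inputs sub g slots (vs[j := u]) = (fill_inputs sub g slots vs)[i := h u]"
  using assms(2-4)
proof (induction slots arbitrary: vs j)
  case Nil
  then show ?case by (simp add: tuples_def)
next
  case (Cons s slots)
  let ?k = "slot_arity sub s"
  have vs: "take ?k vs \<in> tuples ?k X" "drop ?k vs \<in> tuples (\<Sum>i\<leftarrow>slots. slot_arity sub i) X"
    using tuples_split Cons.prems(2) by force+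
  have lk: "?k \<le> length vs" using Cons.prems(2) by (simp add: tuples_def)
  \<comment> \<open>A free slot has arity 1 and \<open>tl\<close> is \<open>drop 1\<close>, so one
    recursion equation covers both kinds of slot.\<close>
  have fill: "fill_inputs sub g (s # slots) ws =
    (case sub s of None \<Rightarrow> g (hd ws) | Some (m, h) \<Rightarrow> h (take m ws)) #
      fill_inputs sub g slots (drop ?k ws)" for ws
    by (auto simp: slot_arity_def drop_Suc split: option.split)
  show ?case
  proof (cases "j < ?k")
    case True
    have "\<exists>h\<in>linear_maps K X Y. \<forall>u\<in>carrier X.
      (case sub s of None \<Rightarrow> g (hd (vs[j := u])) | Some (m, h) \<Rightarrow> h (take m (vs[j := u]))) = h u"
    proof (cases "sub s")
      case None
      then show ?thesis using True lk assms(1)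
        by (intro bexI[of _ g]; cases vs) (auto simp: slot_arity_def)
    next
      case (Some mh)
      obtain m h where mh: "mh = (m, h)" by force
      have "multilinear K m X Y h" using Cons.prems(1)[of s m h] Some mh by simp
      moreover have "take m vs \<in> tuples m X" using vs(1) Some mh by (simp add: slot_arity_def)
      moreover have "j < m" using True Some mh by (simp add: slot_arity_def)
      ultimately have "(\<lambda>u. h ((take m vs)[j := u])) \<in> linear_maps K X Y"
        by (auto simp: multilinear_def)
      then show ?thesis using Some mh
        by (intro bexI[of _ "\<lambda>u. h ((take m vs)[j := u])"]) (auto simp: take_update_swap)
    qed
    then obtain h where "h \<in> linear_maps K X Y"
      and "\<And>u. u \<in> carrier X \<Longrightarrow>
        (case sub s of None \<Rightarrow> g (hd (vs[j := u])) | Some (m, h) \<Rightarrow> h (take m (vs[j := u]))) = h u"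
      by blast
    then show ?thesis unfolding fill using True
      by (intro exI[of _ 0] conjI bexI[of _ h]) auto
  next
    case False
    then have j: "j - ?k < length (drop ?k vs)" using Cons.prems(3) by auto
    have "\<exists>i<length slots. \<exists>h\<in>linear_maps K X Y. \<forall>u\<in>carrier X.
      fill_inputs sub g slots ((drop ?k vs)[j - ?k := u]) = (fill_inputs sub g slots (drop ?k vs))[i := h u]"
      by (rule Cons.IH[OF _ vs(2) j]) (rule Cons.prems(1), auto)
    then obtain i h where ih: "i < length slots"
      "h \<in> linear_maps K X Y" "\<And>u. u \<in> carrier X \<Longrightarrow>
       fill_inputs sub g slots ((drop ?k vs)[j - ?k := u]) = (fill_inputs sub g slots (drop ?k vs))[i := h u]"
      by blast
    have "drop ?k (vs[j := u]) = (drop ?k vs)[j - ?k := u]" for u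
      using False by (simp add: drop_update_swap)
    moreover have "(case sub s of None \<Rightarrow> g (hd (vs[j := u])) | Some (m, h) \<Rightarrow> h (take m (vs[j := u])))
      = (case sub s of None \<Rightarrow> g (hd vs) | Some (m, h) \<Rightarrow> h (take m vs))" for u
    proof (cases "sub s")
      case None
      then show ?thesis using False Cons.prems(3) by (cases vs; cases j) (auto simp: slot_arity_def)
    next
      case (Some mh)
      then show ?thesis using False by (auto simp: slot_arity_def split: prod.splits)
    qed
    ultimately show ?thesis unfolding fill using ih
      by (intro exI[of _ "Suc i"] conjI bexI[of _ h]) auto
  qed
qed

text \<open>Locates the entry produced by a vanishing subtree. The pieces of \<open>vs\<close> have
  the prescribed lengths, so the one handed to slot \<open>s\<close> is a genuine
  \<open>m\<close>-tuple, on which \<open>h\<close> takes the value \<open>z\<close>.\<close>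

lemma fill_inputs_zero:
  assumes "vs \<in> tuples (\<Sum>i\<leftarrow>slots. slot_arity sub i) X" "s \<in> set slots" "sub s = Some (m, h)"
    and "\<And>ws. ws \<in> tuples m X \<Longrightarrow> h ws = z"
  shows "\<exists>i<length slots. fill_inputs sub g slots vs ! i = z"
  using assms(1,2)
proof (induction slots arbitrary: vs)
  case (Cons s' slots)
  let ?k = "slot_arity sub s'"
  have vs: "take ?k vs \<in> tuples ?k X" "drop ?k vs \<in> tuples (\<Sum>i\<leftarrow>slots. slot_arity sub i) X"
    using tuples_split Cons.prems(1) by force+
  show ?case
  proof (cases "s' = s")
    case True
    then show ?thesis using assms(3,4) vs(1) by (intro exI[of _ 0]) (simp add: slot_arity_def)
  next
    case False
    then obtain i where "i < length slots" "fill_inputs sub g slots (drop ?k vs) ! i = z"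
      using Cons.IH[OF vs(2)] Cons.prems(2) by auto
    then show ?thesis
      by (intro exI[of _ "Suc i"]) (auto simp: slot_arity_def drop_Suc split: option.split)
  qed
qed simp

text \<open>The keys of the association list are the occupied slots. They are distinct, so
  \<open>length slots - length ts\<close> slots stay free and count 1 each; the result has the form
  of the recursion for \<open>num_inputs\<close>.\<close>

lemma sum_slot_arity:
  assumes "distinct slots" "distinct (map fst ts)" "fst ` set ts \<subseteq> set slots"
  shows "(\<Sum>i\<leftarrow>slots. slot_arity (map_of ts) i) = (length slots - length ts) + (\<Sum>t\<leftarrow>ts. fst (snd t))"
proof -
  let ?D = "fst ` set ts"
  have fin: "finite ?D" by simp
  have card: "card ?D = length ts" using assms(2) distinct_card by fastforce
  have inj: "inj_on fst (set ts)" using assms(2) by (simp add: distinct_map)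
  have "(\<Sum>i\<leftarrow>slots. slot_arity (map_of ts) i) = (\<Sum>i\<in>set slots. slot_arity (map_of ts) i)"
    using assms(1) by (simp add: sum_list_distinct_conv_sum_set)
  also have "\<dots> = (\<Sum>i\<in>set slots - ?D. slot_arity (map_of ts) i) + (\<Sum>i\<in>?D. slot_arity (map_of ts) i)"
    using assms(3) by (simp add: sum.subset_diff)
  also have "(\<Sum>i\<in>set slots - ?D. slot_arity (map_of ts) i) = (\<Sum>i\<in>set slots - ?D. 1)"
    by (rule sum.cong) (auto simp: slot_arity_def map_of_eq_None_iff split: option.split dest!: map_of_SomeD,
        force)
  also have "\<dots> = length slots - length ts"
    using card assms(1,3) by (simp add: card_Diff_subset distinct_card)
  also have "(\<Sum>i\<in>?D. slot_arity (map_of ts) i) = (\<Sum>t\<in>set ts. slot_arity (map_of ts) (fst t))"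
    using inj by (simp add: sum.reindex)
  also have "\<dots> = (\<Sum>t\<in>set ts. fst (snd t))"
    by (rule sum.cong) (use assms(2) in \<open>auto simp: slot_arity_def\<close>)
  also have "\<dots> = (\<Sum>t\<leftarrow>ts. fst (snd t))"
    using assms(2) by (simp add: sum_list_distinct_conv_sum_set distinct_map)
  finally show ?thesis .
qed

section \<open>Strings\<close>

context small_category
begin

lemma string_obj_closed: "\<phi> \<in> strings C P \<Longrightarrow> i \<le> P \<Longrightarrow> string_obj C \<phi> i \<in> Obj C"
  by (cases i) (auto simp: strings_def string_obj_def Dom_closed)

lemma string_arr_refl: "string_arr C \<phi> k k = Ident C (string_obj C \<phi> k)"
  by (simp add: string_arr_def)

lemma string_arr_step:
  "k < l \<Longrightarrow> string_arr C \<phi> k l = Comp C (snd \<phi> ! k) (string_arr C \<phi> (Suc k) l)"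
  by (simp add: string_arr_def upt_conv_Cons)

lemma string_arr_closed:
  assumes "\<phi> \<in> strings C P" "k \<le> l" "l \<le> P"
  shows "string_arr C \<phi> k l \<in> Arr C \<and> Dom C (string_arr C \<phi> k l) = string_obj C \<phi> l \<and>
    Cod C (string_arr C \<phi> k l) = string_obj C \<phi> k"
  using assms(2)
proof (induction k rule: inc_induct)
  case base
  show ?case using string_obj_closed[OF assms(1,3)]
    by (simp add: string_arr_refl Ident_closed Dom_Ident Cod_Ident)
next
  case (step k)
  have "snd \<phi> ! k \<in> Arr C" "Cod C (snd \<phi> ! k) = string_obj C \<phi> k"
    "Dom C (snd \<phi> ! k) = string_obj C \<phi> (Suc k)"
    using assms(1,3) step.hyps by (auto simp: strings_def string_obj_def)
  then show ?case using step by (simp add: string_arr_step Comp_closed Dom_Comp Cod_Comp)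
qed

lemma string_arr_Suc:
  assumes "\<phi> \<in> strings C P" "k < P"
  shows "string_arr C \<phi> k (Suc k) = snd \<phi> ! k"
proof -
  have "snd \<phi> ! k \<in> Arr C" "Dom C (snd \<phi> ! k) = string_obj C \<phi> (Suc k)"
    using assms by (auto simp: strings_def string_obj_def)
  then show ?thesis using Comp_Ident_right[of "snd \<phi> ! k"] by (simp add: string_arr_step string_arr_refl)
qed

lemma string_obj_pull:
  assumes "\<phi> \<in> strings C P" "mono_on {0..p} \<zeta>" "\<zeta> p \<le> P" "i \<le> p"
  shows "string_obj C (pull C p \<zeta> \<phi>) i = string_obj C \<phi> (\<zeta> i)"
proof (cases i)
  case 0
  then show ?thesis by (simp add: pull_def string_obj_def)
next
  case (Suc j)
  have "\<zeta> j \<le> \<zeta> (Suc j)" "\<zeta> (Suc j) \<le> \<zeta> p"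
    using assms(2,4) Suc by (auto intro: mono_onD)
  then have "Dom C (string_arr C \<phi> (\<zeta> j) (\<zeta> (Suc j))) = string_obj C \<phi> (\<zeta> (Suc j))"
    using string_arr_closed[OF assms(1)] assms(3) by simp
  then show ?thesis using Suc assms(4) by (simp add: pull_def string_obj_def)
qed

lemma pull_strings:
  assumes "\<phi> \<in> strings C P" "mono_on {0..p} \<zeta>" "\<zeta> p \<le> P"
  shows "pull C p \<zeta> \<phi> \<in> strings C p"
proof -
  have arr: "string_arr C \<phi> (\<zeta> i) (\<zeta> (Suc i)) \<in> Arr C \<and>
    Cod C (string_arr C \<phi> (\<zeta> i) (\<zeta> (Suc i))) = string_obj C (pull C p \<zeta> \<phi>) i" if "i < p" for i
  proof -
    have "\<zeta> i \<le> \<zeta> (Suc i)" "\<zeta> (Suc i) \<le> \<zeta> p"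
      using assms(2) that by (auto intro: mono_onD)
    then show ?thesis
      using string_arr_closed[OF assms(1)] assms(3) string_obj_pull[OF assms, of i] that by simp
  qed
  have "\<zeta> 0 \<le> \<zeta> p" using assms(2) by (auto intro: mono_onD)
  then have "fst (pull C p \<zeta> \<phi>) \<in> Obj C"
    using string_obj_closed[OF assms(1)] assms(3) by (simp add: pull_def)
  moreover have "snd (pull C p \<zeta> \<phi>) ! i = string_arr C \<phi> (\<zeta> i) (\<zeta> (Suc i))" if "i < p" for i
    using that by (simp add: pull_def)
  moreover have "length (snd (pull C p \<zeta> \<phi>)) = p" by (simp add: pull_def)
  ultimately show ?thesis using arr by (simp add: strings_def)
qed

text \<open>Component \<open>i\<close> of the pullback is the composite of the arrows between
  positions \<open>\<zeta> i\<close> and \<open>\<zeta> (Suc i)\<close>. When these positions are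
  consecutive it is the single arrow from \<open>j + 1\<close> to \<open>j\<close>, which is entry
  \<open>j\<close> of the list.\<close>

lemma nth_mem_pull:
  assumes "\<phi> \<in> strings C P" "j < P" "i < p" "\<zeta> i = j" "\<zeta> (Suc i) = Suc j"
  shows "snd \<phi> ! j \<in> set (snd (pull C p \<zeta> \<phi>))"
proof -
  have "snd (pull C p \<zeta> \<phi>) ! i = snd \<phi> ! j"
    using assms string_arr_Suc[OF assms(1,2)] by (simp add: pull_def)
  moreover have "length (snd (pull C p \<zeta> \<phi>)) = p" by (simp add: pull_def)
  ultimately show ?thesis using assms(3) nth_mem[of i "snd (pull C p \<zeta> \<phi>)"] by simp
qed

end

section \<open>The planar rose tree of a tree\<close>

text \<open>Uniqueness for the definite description in \<open>child_list\<close>. A head is related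
  to every other element of the common set, so two different heads would be related both ways;
  irreflexivity keeps the head out of its tail, so the tails again have equal sets.\<close>

lemma sorted_wrt_set_unique:
  assumes "\<And>x. \<not> R x x" "\<And>x y. R x y \<Longrightarrow> \<not> R y x"
    and "sorted_wrt R xs" "sorted_wrt R ys" "set xs = set ys"
  shows "xs = ys"
  using assms(3-5)
proof (induction xs arbitrary: ys)
  case (Cons x xs)
  then obtain y ys' where ys: "ys = y # ys'" by (cases ys) auto
  have xy: "x = y"
  proof (rule ccontr)
    assume "x \<noteq> y"
    then have "R x y" "R y x" using Cons.prems unfolding ys by auto
    then show False using assms(2) by blast
  qed
  have "x \<notin> set xs" "y \<notin> set ys'" using Cons.prems assms(1) unfolding ys by auto
  then have "set xs = set ys'" using Cons.prems(3) xy unfolding ys by auto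
  then show ?case using Cons.IH Cons.prems xy unfolding ys by simp
qed simp

text \<open>Existence for the same description: by totality a minimal element is related to all
  others, so it can head a sorted list of the rest.\<close>

lemma ex_sorted_wrt:
  assumes "finite S" "\<And>x. \<not> R x x" "\<And>x y z. R x y \<Longrightarrow> R y z \<Longrightarrow> R x z"
    and "\<And>x y. x \<in> S \<Longrightarrow> y \<in> S \<Longrightarrow> x \<noteq> y \<Longrightarrow> R x y \<or> R y x"
  shows "\<exists>xs. set xs = S \<and> sorted_wrt R xs"
  using assms(1,4)
proof (induction S rule: finite_psubset_induct)
  case (psubset S)
  show ?case
  proof (cases "S = {}")
    case False
    obtain m where m: "m \<in> S" "\<And>x. x \<in> S \<Longrightarrow> x \<noteq> m \<Longrightarrow> \<not> R x m"
      using Finite_Set.bex_min_element[OF psubset.hyps, of R] assms(2,3) False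
      unfolding asymp_on_def transp_on_def by blast
    then obtain xs where "set xs = S - {m}" "sorted_wrt R xs"
      using psubset.IH[of "S - {m}"] psubset.prems by blast
    moreover have "R m x" if "x \<in> S - {m}" for x using m psubset.prems that by blast
    ultimately show ?thesis using m(1) by (intro exI[of _ "m # xs"]) auto
  qed simp
qed

lemma exactly_oneD: "exactly_one [a, b, c, d, e] \<Longrightarrow> a \<or> b \<or> c \<or> d \<or> e"
proof -
  assume "exactly_one [a, b, c, d, e]"
  then obtain i where "i < length [a, b, c, d, e]" and i: "[a, b, c, d, e] ! i"
    unfolding exactly_one_def by blast
  then have "i < 5" by simp
  then have "i = 0 \<or> i = 1 \<or> i = 2 \<or> i = 3 \<or> i = 4" by linarith
  then show ?thesis using i by (elim disjE) simp_all
qed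

fun rose_vertices :: "rose \<Rightarrow> nat list" where
  "rose_vertices (Vertex a ts) = a # concat (map rose_vertices ts)"

text \<open>A relation in place of an equation with \<open>unfold_tree\<close>: it passes to
  subtrees without carrying the recursion bound along, so later inductions on rose trees never see
  that bound.\<close>

fun unfolds :: "nat otree \<Rightarrow> rose \<Rightarrow> bool" where
  "unfolds T (Vertex a ts) \<longleftrightarrow>
     a \<in> verts T \<and> map label ts = child_list T a \<and> (\<forall>t\<in>set ts. unfolds T t)"

lemma hd_rose_vertices: "rose_vertices t \<noteq> [] \<and> hd (rose_vertices t) = label t"
  by (cases t) simp

context
  fixes T :: "nat otree"
  assumes tree: "is_tree T"
begin

lemma edge_verts: "(u, v) \<in> edges T \<Longrightarrow> u \<in> verts T \<and> v \<in> verts T"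
  using tree unfolding is_tree_def by auto

lemma edge_vless: "(u, v) \<in> edges T \<Longrightarrow> vless T u v"
  using tree unfolding is_tree_def by blast

lemma vle_refl: "u \<in> verts T \<Longrightarrow> (u, u) \<in> vle T"
  by (simp add: vle_def)

lemma vle_antisym: "(u, v) \<in> vle T \<Longrightarrow> (v, u) \<in> vle T \<Longrightarrow> u = v"
proof -
  have "antisym (vle T)"
    using tree unfolding is_tree_def partial_order_on_def by auto
  then show "(u, v) \<in> vle T \<Longrightarrow> (v, u) \<in> vle T \<Longrightarrow> u = v" by (rule antisymD)
qed

lemma vle_trans: "(u, v) \<in> vle T \<Longrightarrow> (v, w) \<in> vle T \<Longrightarrow> (u, w) \<in> vle T"
  by (auto simp: vle_def)

lemma hless_trans: "hless T u v \<Longrightarrow> hless T v w \<Longrightarrow> hless T u w"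
proof -
  have "trans (hle T)" "antisym (hle T)"
    using tree unfolding is_tree_def partial_order_on_def preorder_on_def by auto
  then show "hless T u v \<Longrightarrow> hless T v w \<Longrightarrow> hless T u w"
    unfolding hless_def by (meson antisymD transD)
qed

lemma hless_irrefl: "\<not> hless T u u"
  by (simp add: hless_def)

lemma hless_branches:
  "hless T u v \<Longrightarrow> (u, u') \<in> vle T \<Longrightarrow> (v, v') \<in> vle T \<Longrightarrow> hless T u' v'"
  using tree unfolding is_tree_def by blast

lemma comparable:
  assumes "u \<in> verts T" "v \<in> verts T" "u \<noteq> v"
  shows "vless T u v \<or> vless T v u \<or> hless T u v \<or> hless T v u"
proof -
  have "exactly_one [u = v, vless T u v, vless T v u, hless T u v, hless T v u]"
    using tree assms(1,2) unfolding is_tree_def by blast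
  from exactly_oneD[OF this] show ?thesis using assms(3) by blast
qed

text \<open>If one sibling were an ancestor of the other, it would lie strictly between the parent
  and that other child, which an edge forbids. Only the horizontal alternatives remain.\<close>

lemma siblings_comparable:
  assumes "(t, u) \<in> edges T" "(t, v) \<in> edges T" "u \<noteq> v"
  shows "hless T u v \<or> hless T v u"
proof -
  have "\<not> vless T u v" "\<not> vless T v u"
    using tree assms edge_vless unfolding is_tree_def by blast+
  then show ?thesis using comparable[of u v] assms edge_verts by blast
qed

text \<open>Siblings are horizontally related and this relation is inherited by descendants, so a
  common descendant would be strictly related to itself.\<close>

lemma siblings_disjoint:
  assumes "(t, u) \<in> edges T" "(t, v) \<in> edges T" "u \<noteq> v"
  shows "vle T `` {u} \<inter> vle T `` {v} = {}"
  using siblings_comparable[OF assms] hless_branches hless_irrefl by blast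

lemma child_list:
  "set (child_list T v) = {c. (v, c) \<in> edges T} \<and> sorted_wrt (hless T) (child_list T v)"
proof -
  let ?S = "{c. (v, c) \<in> edges T}"
  have "?S \<subseteq> verts T" using edge_verts by blast
  then have "finite ?S" using tree finite_subset unfolding is_tree_def by blast
  then have "\<exists>cs. set cs = ?S \<and> sorted_wrt (hless T) cs"
    by (rule ex_sorted_wrt) (use hless_irrefl hless_trans siblings_comparable in blast)+
  moreover have "cs = cs'" if "set cs = ?S \<and> sorted_wrt (hless T) cs" "set cs' = ?S \<and> sorted_wrt (hless T) cs'"
    for cs cs'
    by (rule sorted_wrt_set_unique[of "hless T"]) (use that hless_irrefl hless_trans in blast)+
  ultimately have "\<exists>!cs. set cs = ?S \<and> sorted_wrt (hless T) cs" by blast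
  from theI'[OF this] show ?thesis unfolding child_list_def .
qed

lemma distinct_child_list: "distinct (child_list T v)"
  using child_list[of v] hless_irrefl
  by (metis (mono_tags) distinct_conv_nth linorder_neqE_nat sorted_wrt_nth_less)

lemma vle_unfold:
  assumes "v \<in> verts T"
  shows "vle T `` {v} = insert v (\<Union>c\<in>{c. (v, c) \<in> edges T}. vle T `` {c})"
proof
  show "vle T `` {v} \<subseteq> insert v (\<Union>c\<in>{c. (v, c) \<in> edges T}. vle T `` {c})"
  proof
    fix u assume "u \<in> vle T `` {v}"
    then have "(v, u) \<in> (edges T)\<^sup>*" "u \<in> verts T" by (auto simp: vle_def)
    then show "u \<in> insert v (\<Union>c\<in>{c. (v, c) \<in> edges T}. vle T `` {c})"
    proof (cases rule: converse_rtranclE)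
      case (step c)
      then have "(c, u) \<in> vle T" using edge_verts \<open>u \<in> verts T\<close> by (auto simp: vle_def)
      then show ?thesis using step by blast
    qed simp
  qed
  show "insert v (\<Union>c\<in>{c. (v, c) \<in> edges T}. vle T `` {c}) \<subseteq> vle T `` {v}"
  proof
    fix u assume "u \<in> insert v (\<Union>c\<in>{c. (v, c) \<in> edges T}. vle T `` {c})"
    then consider "u = v" | c where "(v, c) \<in> edges T" "(c, u) \<in> vle T" by auto
    then show "u \<in> vle T `` {v}"
    proof cases
      case 1
      then show ?thesis using assms vle_refl by simp
    next
      case 2
      then show ?thesis using edge_vless[of v c] vle_trans[of v c u] by (simp add: vless_def)
    qed
  qed
qed

lemma child_below:
  assumes "(v, c) \<in> edges T"
  shows "vle T `` {c} \<subset> vle T `` {v}"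
proof
  have vc: "(v, c) \<in> vle T" "v \<noteq> c" using edge_vless[OF assms] by (auto simp: vless_def)
  then show "vle T `` {c} \<subseteq> vle T `` {v}" using vle_trans[of v c] by auto
  have "v \<in> vle T `` {v}" using vle_refl edge_verts[OF assms] by simp
  moreover have "v \<notin> vle T `` {c}" using vle_antisym[of v c] vc by auto
  ultimately show "vle T `` {c} \<noteq> vle T `` {v}" by blast
qed

lemma finite_below: "finite (vle T `` {v})"
proof (rule finite_subset)
  show "vle T `` {v} \<subseteq> verts T" by (auto simp: vle_def)
  show "finite (verts T)" using tree by (simp add: is_tree_def)
qed

lemma label_unfold_tree: "label (unfold_tree k T v) = v"
  by (cases k) auto

text \<open>Passing to a child strictly shrinks the set of descendants, so depth \<open>k\<close>
  suffices for \<open>k + 1\<close> of them. The offset is right because depth 0 still shows the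
  vertex itself and is correct exactly for leaves.\<close>

lemma unfold_tree_unfolds:
  "v \<in> verts T \<Longrightarrow> card (vle T `` {v}) \<le> Suc k \<Longrightarrow> unfolds T (unfold_tree k T v)"
proof (induction k arbitrary: v)
  case 0
  have "(v, c) \<notin> edges T" for c
  proof
    assume e: "(v, c) \<in> edges T"
    \<comment> \<open>A child would have no descendants at all, although it is one of its
      own.\<close>
    from psubset_card_mono[OF finite_below child_below[OF e]] 0
    have "card (vle T `` {c}) = 0" by simp
    then show False using finite_below[of c] vle_refl edge_verts[OF e] by auto
  qed
  then show ?case using 0 child_list[of v] by simp
next
  case (Suc k)
  have "unfolds T (unfold_tree k T c)" if "(v, c) \<in> edges T" for c
    using psubset_card_mono[OF finite_below child_below[OF that]] Suc.prems edge_verts[OF that]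
    by (intro Suc.IH) auto
  then show ?case using Suc.prems child_list[of v] by (auto simp: label_unfold_tree comp_def)
qed

text \<open>No vertex is listed twice: branches over different children are disjoint, and by
  antisymmetry a vertex does not lie below its own child.\<close>

lemma rose_vertices_unfolds:
  "unfolds T t \<Longrightarrow> set (rose_vertices t) = vle T `` {label t} \<and> distinct (rose_vertices t)"
proof (induction t)
  case (Vertex a ts)
  have cs: "set (map label ts) = {c. (a, c) \<in> edges T}" using child_list[of a] Vertex.prems by simp
  have IH: "set (rose_vertices t) = vle T `` {label t}" "distinct (rose_vertices t)" if "t \<in> set ts" for t
    using Vertex that by auto
  have edge: "(a, label t) \<in> edges T" if "t \<in> set ts" for t using cs that by auto
  have "set (concat (map rose_vertices ts)) = (\<Union>c\<in>set (map label ts). vle T `` {c})"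
    using IH by auto
  then have set: "set (concat (map rose_vertices ts)) = (\<Union>c\<in>{c. (a, c) \<in> edges T}. vle T `` {c})"
    unfolding cs .
  have dl: "distinct (map label ts)" using Vertex.prems distinct_child_list by simp
  have "distinct (concat (map rose_vertices ts))"
  proof (rule distinct_concat)
    \<comment> \<open>A listing begins with the label of its subtree, and siblings have different
      labels.\<close>
    have "inj_on rose_vertices (set ts)"
      using dl hd_rose_vertices unfolding distinct_map inj_on_def by metis
    then show "distinct (map rose_vertices ts)" using dl by (simp add: distinct_map)
    fix xs ys assume "xs \<in> set (map rose_vertices ts)" "ys \<in> set (map rose_vertices ts)" "xs \<noteq> ys"
    then obtain t t' where t: "t \<in> set ts" "t' \<in> set ts" "xs = rose_vertices t" "ys = rose_vertices t'"
      "t \<noteq> t'" by auto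
    then have "label t \<noteq> label t'" using dl by (auto simp: distinct_map inj_on_def)
    then show "set xs \<inter> set ys = {}"
      using siblings_disjoint[OF edge edge] IH t by simp
  qed (use IH in auto)
  moreover have "a \<notin> (\<Union>c\<in>{c. (a, c) \<in> edges T}. vle T `` {c})"
    using edge_vless vle_antisym unfolding vless_def by blast
  ultimately show ?case using set vle_unfold[of a] Vertex.prems by simp
qed

text \<open>A minimal element among the ancestors of \<open>u\<close> is minimal in the whole tree,
  since anything below it is again an ancestor of \<open>u\<close>. By uniqueness of the root it is
  \<open>r\<close>.\<close>

lemma below_root: assumes "is_root T r" shows "vle T `` {r} = verts T"
proof
  show "vle T `` {r} \<subseteq> verts T" by (auto simp: vle_def)
  show "verts T \<subseteq> vle T `` {r}"
  proof
    fix u assume u: "u \<in> verts T"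
    let ?B = "{w. (w, u) \<in> vle T}"
    have "finite ?B" using tree by (auto intro!: finite_subset[of ?B "verts T"] simp: is_tree_def vle_def)
    moreover have "asymp_on ?B (vless T)" "transp_on ?B (vless T)"
      unfolding asymp_on_def transp_on_def vless_def using vle_antisym vle_trans by blast+
    moreover have "?B \<noteq> {}" using u vle_refl by auto
    ultimately have "\<exists>m\<in>?B. \<forall>x\<in>?B. x \<noteq> m \<longrightarrow> \<not> vless T x m"
      by (rule Finite_Set.bex_min_element)
    then obtain m where m: "(m, u) \<in> vle T" "\<And>x. (x, u) \<in> vle T \<Longrightarrow> x \<noteq> m \<Longrightarrow> \<not> vless T x m"
      by blast
    have "\<not> vless T x m" for x
      using m vle_trans[of x m u] by (auto simp: vless_def)
    moreover have "m \<in> verts T" using m(1) by (simp add: vle_def)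
    ultimately have "is_root T m" by (simp add: is_root_def)
    then have "m = r" using assms tree unfolding is_tree_def by blast
    then show "u \<in> vle T `` {r}" using m by blast
  qed
qed

lemma is_root_verts: "is_root T r \<Longrightarrow> r \<in> verts T"
  by (simp add: is_root_def)

lemma rose_of_unfolds: "unfolds T (rose_of T)"
  and set_rose_vertices: "set (rose_vertices (rose_of T)) = verts T"
  and distinct_rose_vertices: "distinct (rose_vertices (rose_of T))"
proof -
  have root: "is_root T (THE r. is_root T r)"
  proof (rule theI')
    show "\<exists>!r. is_root T r" using tree unfolding is_tree_def by blast
  qed
  then show u: "unfolds T (rose_of T)" unfolding rose_of_def
    using below_root[OF root] is_root_verts[OF root]
    by (intro unfold_tree_unfolds) simp_all
  show "set (rose_vertices (rose_of T)) = verts T" "distinct (rose_vertices (rose_of T))"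
    using rose_vertices_unfolds[OF u] below_root[OF root] by (auto simp: rose_of_def label_unfold_tree)
qed

text \<open>A coloring increases strictly along the planar order of the children, so they occupy
  different slots. The bound on \<open>length ts\<close> makes the truncated subtraction in
  \<open>num_inputs\<close> exact.\<close>

lemma coloring_slots:
  assumes "I \<in> tree_colorings T q" "unfolds T (Vertex a ts)"
  shows "distinct (map (\<lambda>t. I (a, label t)) ts)" "(\<lambda>t. I (a, label t)) ` set ts \<subseteq> {1..q a}"
    "length ts \<le> q a"
proof -
  have cs: "map label ts = child_list T a" using assms(2) by simp
  have c: "set (child_list T a) = {c. (a, c) \<in> edges T}" "sorted_wrt (hless T) (child_list T a)"
    using child_list by auto
  have I: "I (a, c) < I (a, d)" if "hless T c d" "(a, c) \<in> edges T" "(a, d) \<in> edges T" for c d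
    using assms(1) that by (auto simp: tree_colorings_def)
  have "sorted_wrt (<) (map (\<lambda>c. I (a, c)) (child_list T a))"
    unfolding sorted_wrt_map
    by (rule sorted_wrt_mono_rel[OF _ c(2)]) (use I c(1) in auto)
  then show d: "distinct (map (\<lambda>t. I (a, label t)) ts)"
    unfolding cs[symmetric] by (simp add: strict_sorted_iff comp_def)
  have "(\<lambda>c. I (a, c)) ` set (map label ts) \<subseteq> {1..q a}"
  proof -
    have "I \<in> (\<Pi>\<^sub>E (u, v)\<in>edges T. {1..q u})" using assms(1) by (simp add: tree_colorings_def)
    then have "I (a, c) \<in> {1..q a}" if "(a, c) \<in> edges T" for c
      using PiE_mem[OF _ that, of I "\<lambda>(u, v). {1..q u}"] by simp
    then show ?thesis using c(1) unfolding cs by blast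
  qed
  then show s: "(\<lambda>t. I (a, label t)) ` set ts \<subseteq> {1..q a}" by auto
  have "length ts = card ((\<lambda>t. I (a, label t)) ` set ts)"
    using distinct_card[OF d] by simp
  also have "\<dots> \<le> q a" using card_mono[OF _ s] by simp
  finally show "length ts \<le> q a" .
qed

lemma int_sum_list: "int (\<Sum>x\<leftarrow>xs. f x) = (\<Sum>x\<leftarrow>xs. int (f x))"
  by (induction xs) auto

text \<open>Each child occupies one slot of its parent, and the summand 1 in the formula for its
  subtree cancels that slot. The identity is stated over the integers because \<open>q a - 1\<close>
  is negative when \<open>q a = 0\<close>.\<close>

lemma num_inputs_unfolds:
  assumes "I \<in> tree_colorings T q"
  shows "unfolds T t \<Longrightarrow> int (num_inputs q t) = 1 + (\<Sum>a\<leftarrow>rose_vertices t. int (q a) - 1)"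
proof (induction t)
  case (Vertex a ts)
  have "(\<Sum>t\<leftarrow>ts. int (num_inputs q t)) = (\<Sum>t\<leftarrow>ts. 1 + (\<Sum>a\<leftarrow>rose_vertices t. int (q a) - 1))"
    using Vertex by (intro arg_cong[of _ _ sum_list] map_cong) auto
  also have "\<dots> = int (length ts) + (\<Sum>a\<leftarrow>concat (map rose_vertices ts). int (q a) - 1)"
    by (induction ts) auto
  finally show ?case
    using coloring_slots(3)[OF assms Vertex.prems] by (simp add: int_sum_list comp_def of_nat_diff)
qed

end

section \<open>Colorings of words\<close>

text \<open>Trades the maps \<open>\<pi>\<close> for the endpoints \<open>lo k\<close> and
  \<open>hi k\<close> of the block of each occurrence \<open>k\<close>, so that later arguments are
  about a chain of intervals only.\<close>

lemma word_coloring_intervals: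
  assumes "W \<in> F2S n" "\<zeta> \<in> word_colorings n W p"
  obtains lo hi :: "nat \<Rightarrow> nat" where
    "\<And>k. k < length W \<Longrightarrow> lo k \<le> hi k"
    "\<And>k. Suc k < length W \<Longrightarrow> hi k = lo (Suc k)"
    "\<And>k. k < length W \<Longrightarrow> {lo k..hi k} \<subseteq> \<zeta> (W ! k) ` {0..p (W ! k)}"
    "\<And>a i. a \<in> {1..n} \<Longrightarrow> i \<le> p a \<Longrightarrow> \<exists>k<length W. W ! k = a \<and> \<zeta> a i \<in> {lo k..hi k}"
proof -
  obtain \<pi> where pi: "\<pi> \<in> occ_maps n W p \<zeta>"
    using assms(2) unfolding word_colorings_def by blast
  let ?B = "occ_block W p \<zeta> \<pi>"
  have img: "\<pi> a ` {0..p a} = {k. k < length W \<and> W ! k = a}" if "a \<in> {1..n}" for a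
    using pi that unfolding occ_maps_def by blast
  have ne: "?B k \<noteq> {}" if k: "k < length W" for k
  proof -
    have "W ! k \<in> {1..n}" using assms(1) nth_mem[OF k] unfolding F2S_def by blast
    from img[OF this] k have "k \<in> \<pi> (W ! k) ` {0..p (W ! k)}" by simp
    then show ?thesis by (auto simp: occ_block_def)
  qed
  \<comment> \<open>The definition allows \<open>{l..m}\<close> with \<open>m < l\<close>. Since
    \<open>\<pi>\<close> hits every occurrence the block is nonempty, and so \<open>Min\<close> and
    \<open>Max\<close> are its endpoints.\<close>
  have B: "?B k = {Min (?B k)..Max (?B k)} \<and> Min (?B k) \<le> Max (?B k)" if k: "k < length W" for k
  proof -
    obtain l m where lm: "?B k = {l..m}" using pi k unfolding occ_maps_def by blast
    then have "l \<le> m" using ne[OF k] by simp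
    then have "Min {l..m} = l" "Max {l..m} = m" by (auto intro!: Min_eqI Max_eqI)
    then show ?thesis using lm \<open>l \<le> m\<close> by simp
  qed
  show thesis
  proof (rule that)
    show "Min (?B k) \<le> Max (?B k)" if "k < length W" for k using B[OF that] by blast
    show "Max (?B k) = Min (?B (Suc k))" if "Suc k < length W" for k
      using pi that unfolding occ_maps_def by blast
    show "{Min (?B k)..Max (?B k)} \<subseteq> \<zeta> (W ! k) ` {0..p (W ! k)}" if "k < length W" for k
    proof -
      have "?B k \<subseteq> \<zeta> (W ! k) ` {0..p (W ! k)}" by (auto simp: occ_block_def)
      then show ?thesis using B[OF that] by simp
    qed
    show "\<exists>k<length W. W ! k = a \<and> \<zeta> a i \<in> {Min (?B k)..Max (?B k)}"
      if a: "a \<in> {1..n}" and i: "i \<le> p a" for a i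
    proof (intro exI conjI)
      have "\<pi> a i \<in> \<pi> a ` {0..p a}" using i by simp
      then show k: "\<pi> a i < length W" "W ! \<pi> a i = a" using img[OF a] by auto
      have "\<zeta> a i \<in> ?B (\<pi> a i)" using k i by (auto simp: occ_block_def)
      then show "\<zeta> a i \<in> {Min (?B (\<pi> a i))..Max (?B (\<pi> a i))}" using B[OF k(1)] by simp
    qed
  qed
qed

lemma chain_intervals:
  fixes lo hi :: "nat \<Rightarrow> nat"
  assumes "\<And>k. k < l \<Longrightarrow> lo k \<le> hi k" "\<And>k. Suc k < l \<Longrightarrow> hi k = lo (Suc k)" "k < k'" "k' < l"
  shows "hi k \<le> lo k'"
  using assms(3,4)
proof (induction k')
  case (Suc k')
  show ?case
  proof (cases "k = k'")
    case True
    then show ?thesis using assms(2) Suc.prems by simp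
  next
    case False
    then have "hi k \<le> lo k'" using Suc by simp
    also have "\<dots> \<le> hi k'" using assms(1) Suc.prems by simp
    finally show ?thesis using assms(2) Suc.prems by simp
  qed
qed simp

lemma word_coloring_strict_mono:
  "\<zeta> \<in> word_colorings n W p \<Longrightarrow> a \<in> {1..n} \<Longrightarrow> strict_mono_on {0..p a} (\<zeta> a)"
  unfolding word_colorings_def by blast

lemma word_coloring_le:
  assumes "\<zeta> \<in> word_colorings n W p" "a \<in> {1..n}" "i \<le> p a"
  shows "\<zeta> a i \<le> out_p n W p"
proof -
  have "(\<Union>a\<in>{1..n}. \<zeta> a ` {0..p a}) = {0..out_p n W p}"
    using assms(1) unfolding word_colorings_def by blast
  moreover have "\<zeta> a i \<in> (\<Union>a\<in>{1..n}. \<zeta> a ` {0..p a})"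
    using assms(2,3) by (intro UN_I[of a] imageI) auto
  ultimately show ?thesis by simp
qed

text \<open>The blocks of consecutive occurrences overlap in a single point, so that every step
  \<open>j, j + 1\<close> lies in one block.\<close>

lemma word_coloring_step:
  assumes "W \<in> F2S n" "\<zeta> \<in> word_colorings n W p" "j < out_p n W p"
  shows "\<exists>a\<in>{1..n}. \<exists>i<p a. \<zeta> a i = j \<and> \<zeta> a (Suc i) = Suc j"
proof -
  obtain lo hi where lh: "\<And>k. k < length W \<Longrightarrow> lo k \<le> hi k"
    "\<And>k. Suc k < length W \<Longrightarrow> hi k = lo (Suc k)"
    "\<And>k. k < length W \<Longrightarrow> {lo k..hi k} \<subseteq> \<zeta> (W ! k) ` {0..p (W ! k)}"
    "\<And>a i. a \<in> {1..n} \<Longrightarrow> i \<le> p a \<Longrightarrow> \<exists>k<length W. W ! k = a \<and> \<zeta> a i \<in> {lo k..hi k}"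
    by (rule word_coloring_intervals[OF assms(1,2)]) (rule that)
  have cover: "\<exists>k<length W. x \<in> {lo k..hi k}" if "x \<le> out_p n W p" for x
  proof -
    have "(\<Union>a\<in>{1..n}. \<zeta> a ` {0..p a}) = {0..out_p n W p}"
      using assms(2) unfolding word_colorings_def by blast
    then have "x \<in> (\<Union>a\<in>{1..n}. \<zeta> a ` {0..p a})" using that by simp
    then obtain a i where "a \<in> {1..n}" "i \<le> p a" "x = \<zeta> a i" by auto
    then show ?thesis using lh(4)[of a i] by blast
  qed
  \<comment> \<open>The last block starting at or before \<open>j\<close> also contains
    \<open>j + 1\<close>: a following block starts after \<open>j\<close>, and it starts where this
    one ends.\<close>
  define S where "S = {k. k < length W \<and> lo k \<le> j}"
  define k where "k = Max S"
  have "finite S" "S \<noteq> {}" using cover[of j] assms(3) by (auto simp: S_def)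
  then have "k \<in> S" "\<And>k'. k' \<in> S \<Longrightarrow> k' \<le> k" by (auto simp: k_def)
  then have k: "k < length W" "lo k \<le> j" and max: "\<And>k'. k' < length W \<Longrightarrow> lo k' \<le> j \<Longrightarrow> k' \<le> k"
    by (auto simp: S_def)
  have "Suc j \<le> hi k"
  proof (cases "Suc k < length W")
    case True
    then show ?thesis using max[of "Suc k"] lh(2)[of k] by force
  next
    case False
    \<comment> \<open>No block follows. Some block reaches \<open>j + 1\<close>, and an earlier one
      would have to end by \<open>lo k\<close>, which is at most \<open>j\<close>.\<close>
    obtain k' where k': "k' < length W" "Suc j \<le> hi k'" using cover[of "Suc j"] assms(3) by auto
    show ?thesis
    proof (cases "k' = k")
      case True
      then show ?thesis using k' by simp
    next
      case False
      then have "k' < k" using k' \<open>\<not> Suc k < length W\<close> by simp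
      then have "hi k' \<le> lo k" using chain_intervals[of "length W" lo hi k' k] lh k(1) by blast
      then show ?thesis using k' k by simp
    qed
  qed
  let ?a = "W ! k"
  have a: "?a \<in> {1..n}" using assms(1) nth_mem[OF k(1)] unfolding F2S_def by blast
  have "j \<in> {lo k..hi k}" "Suc j \<in> {lo k..hi k}" using k \<open>Suc j \<le> hi k\<close> by auto
  then have "j \<in> \<zeta> ?a ` {0..p ?a}" "Suc j \<in> \<zeta> ?a ` {0..p ?a}" using lh(3)[OF k(1)] by blast+
  then obtain i i' where i: "i \<le> p ?a" "\<zeta> ?a i = j" "i' \<le> p ?a" "\<zeta> ?a i' = Suc j" by auto
  note mono = strict_mono_onD[OF word_coloring_strict_mono[OF assms(2) a]]
  have "i < i'" using mono[of i' i] i by (cases i i' rule: linorder_cases) auto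
  \<comment> \<open>An argument strictly between \<open>i\<close> and \<open>i'\<close> would have
    its value strictly between \<open>j\<close> and \<open>j + 1\<close>.\<close>
  moreover have "\<not> Suc i < i'" using mono[of i "Suc i"] mono[of "Suc i" i'] i by auto
  ultimately have "i' = Suc i" by simp
  then show ?thesis using a i by (intro bexI[of _ ?a] exI[of _ i]) auto
qed

text \<open>Condition (1) on quilts forbids an occurrence of the child \<open>b\<close> before one
  of its parent \<open>a\<close>. So the block with the last value of \<open>\<zeta> a\<close>
  precedes the block with the first value of \<open>\<zeta> b\<close>. The inequality gives the
  arrow along the edge its meaning.\<close>

lemma quilt_coloring_edge:
  assumes "(W, T) \<in> Quilt n" "\<zeta> \<in> word_colorings n W p" "(a, b) \<in> edges T"
  shows "\<zeta> a (p a) \<le> \<zeta> b 0"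
proof -
  have W: "W \<in> F2S n" and T: "is_tree T" "verts T = {1..n}"
    using assms(1) by (auto simp: Quilt_def Tree_def)
  have order: "\<not> vless T (W ! j) (W ! i)" if "i < j" "j < length W" for i j
    using assms(1) that by (simp add: Quilt_def)
  have ab: "a \<in> {1..n}" "b \<in> {1..n}" "vless T a b"
    using edge_verts[OF T(1) assms(3)] edge_vless[OF T(1) assms(3)] T(2) by auto
  obtain lo hi where lh: "\<And>k. k < length W \<Longrightarrow> lo k \<le> hi k"
    "\<And>k. Suc k < length W \<Longrightarrow> hi k = lo (Suc k)"
    "\<And>a i. a \<in> {1..n} \<Longrightarrow> i \<le> p a \<Longrightarrow> \<exists>k<length W. W ! k = a \<and> \<zeta> a i \<in> {lo k..hi k}"
    by (rule word_coloring_intervals[OF W assms(2)]) (rule that)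
  obtain k where k: "k < length W" "W ! k = a" "\<zeta> a (p a) \<le> hi k" using lh(3)[OF ab(1), of "p a"] by auto
  obtain k' where k': "k' < length W" "W ! k' = b" "lo k' \<le> \<zeta> b 0" using lh(3)[OF ab(2), of 0] by auto
  have "\<not> k' < k" using order[of k' k] k k' ab(3) by auto
  moreover have "k \<noteq> k'" using k k' ab(3) by (auto simp: vless_def)
  ultimately have "hi k \<le> lo k'" using chain_intervals[of "length W" lo hi k k'] lh k'(1) by simp
  then show ?thesis using k k' by simp
qed

section \<open>Cochains\<close>

context vec_functor
begin

lemma module_string: "\<phi> \<in> strings C P \<Longrightarrow> i \<le> P \<Longrightarrow> module K (V (string_obj C \<phi> i))"
  by (simp add: V_module string_obj_closed)

lemma src_string: "\<phi> \<in> strings C P \<Longrightarrow> src \<phi> = V (string_obj C \<phi> P)"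
  by (simp add: src_def strings_def)

lemma module_src: "\<phi> \<in> strings C P \<Longrightarrow> module K (src \<phi>)"
  by (simp add: src_string module_string)

lemma module_tgt: "\<phi> \<in> strings C P \<Longrightarrow> module K (tgt \<phi>)"
  by (simp add: tgt_def module_string)

lemma A_string_arr:
  assumes "\<phi> \<in> strings C P" "k \<le> l" "l \<le> P"
  shows "A (string_arr C \<phi> k l) \<in> linear_maps K (V (string_obj C \<phi> l)) (V (string_obj C \<phi> k))"
  using A_linear[of "string_arr C \<phi> k l"] string_arr_closed[OF assms] by simp

lemma src_pull:
  assumes "\<phi> \<in> strings C P" "mono_on {0..p} \<zeta>" "\<zeta> p \<le> P"
  shows "src (pull C p \<zeta> \<phi>) = V (string_obj C \<phi> (\<zeta> p))"
  using src_string[OF pull_strings[OF assms]] string_obj_pull[OF assms, of p] by simp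

lemma tgt_pull:
  assumes "\<phi> \<in> strings C P" "mono_on {0..p} \<zeta>" "\<zeta> p \<le> P"
  shows "tgt (pull C p \<zeta> \<phi>) = V (string_obj C \<phi> (\<zeta> 0))"
  using string_obj_pull[OF assms, of 0] by (simp add: tgt_def)

section \<open>Degenerate strings and reduced cochains\<close>

definition degenerate :: "'o \<times> 'm list \<Rightarrow> bool"
  where "degenerate \<phi> \<longleftrightarrow> (\<exists>x\<in>Obj C. Ident C x \<in> set (snd \<phi>))"

lemma degenerateE:
  assumes "degenerate \<phi>" "\<phi> \<in> strings C P"
  obtains j x where "j < P" "x \<in> Obj C" "snd \<phi> ! j = Ident C x"
  using assms by (auto simp: degenerate_def strings_def in_set_conv_nth)

lemma degenerate_pull:
  assumes "\<phi> \<in> strings C P" "j < P" "x \<in> Obj C" "snd \<phi> ! j = Ident C x"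
    and "i < p" "\<zeta> i = j" "\<zeta> (Suc i) = Suc j"
  shows "degenerate (pull C p \<zeta> \<phi>)"
  using nth_mem_pull[OF assms(1,2,5-7)] assms(3,4) by (auto simp: degenerate_def)

lemma cochain_multilinear:
  "f \<in> cochains p q \<Longrightarrow> \<phi> \<in> strings C p \<Longrightarrow> multilinear K q (src \<phi>) (tgt \<phi>) (f \<phi>)"
  unfolding cochains_def using multilinear_maps_iff by blast

lemma cochain_eqI:
  assumes "f \<in> cochains p q" "g \<in> cochains p q"
    and "\<And>\<phi> vs. \<phi> \<in> strings C p \<Longrightarrow> vs \<in> tuples q (src \<phi>) \<Longrightarrow> f \<phi> vs = g \<phi> vs"
  shows "f = g"
proof (rule PiE_ext[OF assms(1)[unfolded cochains_def] assms(2)[unfolded cochains_def]])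
  fix \<phi> assume \<phi>: "\<phi> \<in> strings C p"
  then have "f \<phi> \<in> extensional (tuples q (src \<phi>))" "g \<phi> \<in> extensional (tuples q (src \<phi>))"
    using assms(1,2) multilinear_maps_iff unfolding cochains_def by blast+
  then show "f \<phi> = g \<phi>" by (rule extensionalityI) (use assms(3) \<phi> in blast)
qed

lemma cochainI:
  assumes "\<And>\<phi>. \<phi> \<in> strings C p \<Longrightarrow> multilinear K q (src \<phi>) (tgt \<phi>) (G \<phi>)"
  shows "(\<lambda>\<phi>\<in>strings C p. \<lambda>vs\<in>tuples q (src \<phi>). G \<phi> vs) \<in> cochains p q"
  unfolding cochains_def
proof (rule restrict_PiE_iff[THEN iffD2], rule ballI)
  fix \<phi> assume "\<phi> \<in> strings C p"
  then show "(\<lambda>vs\<in>tuples q (src \<phi>). G \<phi> vs) \<in> multilinear_maps K q (src \<phi>) (tgt \<phi>)"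
    using restrict_multilinear_maps[OF module_src assms] by blast
qed

text \<open>The differential, the quilt operations and the module operations are all given by such a
  double restriction, so each closure statement splits into multilinearity for every string and
  vanishing on degenerate ones.\<close>

lemma reduced_cochainI:
  assumes "\<And>\<phi>. \<phi> \<in> strings C p \<Longrightarrow> multilinear K q (src \<phi>) (tgt \<phi>) (G \<phi>)"
    and "\<And>\<phi> vs. \<phi> \<in> strings C p \<Longrightarrow> degenerate \<phi> \<Longrightarrow> vs \<in> tuples q (src \<phi>) \<Longrightarrow> G \<phi> vs = \<zero>\<^bsub>tgt \<phi>\<^esub>"
  shows "(\<lambda>\<phi>\<in>strings C p. \<lambda>vs\<in>tuples q (src \<phi>). G \<phi> vs) \<in> reduced_cochains p q"
    (is "?F \<in> _")
proof -
  have "?F \<phi> = (\<lambda>vs\<in>tuples q (src \<phi>). \<zero>\<^bsub>tgt \<phi>\<^esub>)"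
    if "\<phi> \<in> strings C p" "\<exists>x\<in>Obj C. Ident C x \<in> set (snd \<phi>)" for \<phi>
    using assms(2)[OF that(1)] that by (auto simp: degenerate_def intro!: restrict_ext)
  then show ?thesis using cochainI[OF assms(1)] unfolding reduced_cochains_def by blast
qed

lemma reduced_cochain: "f \<in> reduced_cochains p q \<Longrightarrow> f \<in> cochains p q"
  by (simp add: reduced_cochains_def)

lemma reduced_cochain_degenerate:
  "f \<in> reduced_cochains p q \<Longrightarrow> \<phi> \<in> strings C p \<Longrightarrow> degenerate \<phi> \<Longrightarrow> vs \<in> tuples q (src \<phi>) \<Longrightarrow>
    f \<phi> vs = \<zero>\<^bsub>tgt \<phi>\<^esub>"
  by (simp add: reduced_cochains_def degenerate_def)

lemma zero_cochain_reduced: "zero_cochain p q \<in> reduced_cochains p q"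
  unfolding zero_cochain_def
  by (rule reduced_cochainI) (auto intro: multilinear_zero module_src module_tgt)

lemma zero_cochain_apply:
  "\<phi> \<in> strings C p \<Longrightarrow> vs \<in> tuples q (src \<phi>) \<Longrightarrow> zero_cochain p q \<phi> vs = \<zero>\<^bsub>tgt \<phi>\<^esub>"
  by (simp add: zero_cochain_def)

section \<open>The simplicial differential\<close>

lemma mono_coface: "mono_on S (coface i)"
  by (auto simp: mono_on_def coface_def)

definition face_term :: "nat \<Rightarrow> ('o, 'm, 'v) cochain \<Rightarrow> nat \<Rightarrow> ('o, 'm, 'v) cochain" where
  "face_term p f i \<phi> vs = A (string_arr C \<phi> 0 (coface i 0))
     (f (pull C p (coface i) \<phi>) (map (A (string_arr C \<phi> (coface i p) (Suc p))) vs))"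

lemma face_term_inputs:
  assumes "\<phi> \<in> strings C (Suc p)" "vs \<in> tuples q (src \<phi>)"
  shows "map (A (string_arr C \<phi> (coface i p) (Suc p))) vs \<in> tuples q (src (pull C p (coface i) \<phi>))"
  using map_tuples[OF A_string_arr[OF assms(1), of "coface i p" "Suc p"]] assms
    src_pull[OF assms(1) mono_coface, of i p] src_string[OF assms(1)]
  by (simp add: coface_def)

lemma face_term_multilinear:
  assumes "f \<in> cochains p q" "\<phi> \<in> strings C (Suc p)"
  shows "multilinear K q (src \<phi>) (tgt \<phi>) (face_term p f i \<phi>)"
proof -
  have le: "coface i p \<le> Suc p" "coface i 0 \<le> Suc p" by (auto simp: coface_def)
  let ?\<psi> = "pull C p (coface i) \<phi>"
  have "multilinear K q (src ?\<psi>) (tgt ?\<psi>) (f ?\<psi>)"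
    by (rule cochain_multilinear[OF assms(1) pull_strings[OF assms(2) mono_coface le(1)]])
  then have "multilinear K q (V (string_obj C \<phi> (coface i p))) (V (string_obj C \<phi> (coface i 0))) (f ?\<psi>)"
    by (simp only: src_pull[OF assms(2) mono_coface le(1)] tgt_pull[OF assms(2) mono_coface le(1)])
  from multilinear_map[OF module_src[OF assms(2)] this]
  have "multilinear K q (src \<phi>) (V (string_obj C \<phi> (coface i 0)))
    (\<lambda>vs. f ?\<psi> (map (A (string_arr C \<phi> (coface i p) (Suc p))) vs))"
    using A_string_arr[OF assms(2) le(1)] src_string[OF assms(2)] by simp
  from multilinear_postcomp[OF this] show ?thesis
    using A_string_arr[OF assms(2) _ le(2), of 0] unfolding face_term_def tgt_def by simp
qed

lemma face_term_zero:
  assumes "\<phi> \<in> strings C (Suc p)" "vs \<in> tuples q (src \<phi>)"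
    and "\<And>ws. ws \<in> tuples q (src (pull C p (coface i) \<phi>)) \<Longrightarrow>
      f (pull C p (coface i) \<phi>) ws = \<zero>\<^bsub>tgt (pull C p (coface i) \<phi>)\<^esub>"
  shows "face_term p f i \<phi> vs = \<zero>\<^bsub>tgt \<phi>\<^esub>"
proof -
  have le: "coface i p \<le> Suc p" "coface i 0 \<le> Suc p" by (auto simp: coface_def)
  have "f (pull C p (coface i) \<phi>) (map (A (string_arr C \<phi> (coface i p) (Suc p))) vs)
    = \<zero>\<^bsub>V (string_obj C \<phi> (coface i 0))\<^esub>"
    using assms(3)[OF face_term_inputs[OF assms(1,2)]] tgt_pull[OF assms(1) mono_coface le(1)] by simp
  then show ?thesis
    using linear_maps_zero[OF module_string[OF assms(1) le(2)] module_string[OF assms(1), of 0]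
        A_string_arr[OF assms(1) _ le(2), of 0]]
    by (simp add: face_term_def tgt_def)
qed

lemma delta_S_face_term:
  "delta_S p q f = (\<lambda>\<phi>\<in>strings C (Suc p). \<lambda>vs\<in>tuples q (src \<phi>).
     \<Oplus>\<^bsub>tgt \<phi>\<^esub>i\<in>{0..Suc p}. [((-1) ^ i :: int)] \<cdot>\<^bsub>tgt \<phi>\<^esub> face_term p f i \<phi> vs)"
  unfolding delta_S_def face_term_def ..

text \<open>The position \<open>j + 1\<close> is identified with \<open>j\<close>, the arrow between them being an identity.\<close>

definition collapse :: "nat \<Rightarrow> nat \<Rightarrow> nat"
  where "collapse j i = (if i = Suc j then j else i)"

text \<open>The two cofaces differ only at \<open>i = j\<close>, where they take the values
  \<open>j + 1\<close> and \<open>j\<close>.\<close>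

lemma collapse_coface: "collapse j (coface j i) = collapse j (coface (Suc j) i)"
  by (auto simp: collapse_def coface_def)

context
  fixes \<phi> P j x
  assumes \<phi>: "\<phi> \<in> strings C P" and j: "j < P" and x: "x \<in> Obj C" "snd \<phi> ! j = Ident C x"
begin

lemma string_obj_identity: "string_obj C \<phi> (Suc j) = string_obj C \<phi> j" "string_obj C \<phi> j = x"
proof -
  have "Cod C (snd \<phi> ! j) = string_obj C \<phi> j" using \<phi> j by (simp add: strings_def)
  then show "string_obj C \<phi> j = x" using x by (simp add: Cod_Ident)
  then show "string_obj C \<phi> (Suc j) = string_obj C \<phi> j" using x by (simp add: string_obj_def Dom_Ident)
qed

lemma string_obj_collapse: "string_obj C \<phi> (collapse j i) = string_obj C \<phi> i"
  using string_obj_identity by (simp add: collapse_def)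

lemma string_arr_to_identity:
  assumes "k \<le> j" shows "string_arr C \<phi> k (Suc j) = string_arr C \<phi> k j"
  using assms
proof (induction k rule: inc_induct)
  case base
  show ?case using string_arr_Suc[OF \<phi> j] string_obj_identity x by (simp add: string_arr_refl)
next
  case (step k)
  then show ?case by (simp add: string_arr_step)
qed

lemma string_arr_from_identity:
  assumes "Suc j \<le> l" "l \<le> P" shows "string_arr C \<phi> (Suc j) l = string_arr C \<phi> j l"
proof -
  have "string_arr C \<phi> (Suc j) l \<in> Arr C" "Cod C (string_arr C \<phi> (Suc j) l) = x"
    using string_arr_closed[OF \<phi> assms] string_obj_identity by auto
  then show ?thesis using Comp_Ident_left[of "string_arr C \<phi> (Suc j) l"] x assms
    by (simp add: string_arr_step)
qed

text \<open>Moving an endpoint from \<open>j + 1\<close> to \<open>j\<close> adds or removes only an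
  identity arrow. Positions above \<open>j + 1\<close> are not renumbered by
  \<open>collapse\<close>, so both sides are arrows of the same string.\<close>

lemma string_arr_collapse:
  assumes "k \<le> l" "l \<le> P"
  shows "string_arr C \<phi> (collapse j k) (collapse j l) = string_arr C \<phi> k l"
proof (cases "k = Suc j")
  case True
  show ?thesis
  proof (cases "l = Suc j")
    case False
    then show ?thesis using string_arr_from_identity[of l] True assms by (simp add: collapse_def)
  qed (use True string_obj_identity in \<open>simp add: string_arr_refl collapse_def\<close>)
next
  case False
  then show ?thesis using string_arr_to_identity[of k] assms
    by (cases "l = Suc j") (auto simp: collapse_def)
qed

text \<open>Every ingredient of a face is an object or arrow of the string at positions given by the
  coface, hence depends on these positions only after collapsing. The facts \<open>first\<close> and
  \<open>last\<close> treat the outer maps and thereby the end faces, \<open>j = 0\<close> and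
  \<open>j = p\<close>.\<close>

lemma face_term_identity:
  assumes "P = Suc p"
  shows "face_term p f j \<phi> vs = face_term p f (Suc j) \<phi> vs"
proof -
  have le: "coface i k \<le> P" if "k \<le> p" for i k using that assms by (auto simp: coface_def)
  have arr: "string_arr C \<phi> (coface j k) (coface j l) = string_arr C \<phi> (coface (Suc j) k) (coface (Suc j) l)"
    if "k \<le> l" "l \<le> p" for k l
  proof -
    have "coface i k \<le> coface i l" for i using that by (auto simp: coface_def)
    from string_arr_collapse[OF this le[OF that(2)], of j] string_arr_collapse[OF this le[OF that(2)], of "Suc j"]
    show ?thesis by (simp add: collapse_coface)
  qed
  have obj: "string_obj C \<phi> (coface j 0) = string_obj C \<phi> (coface (Suc j) 0)"
    using string_obj_collapse[of "coface j 0"] string_obj_collapse[of "coface (Suc j) 0"]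
    by (simp add: collapse_coface)
  have first: "string_arr C \<phi> 0 (coface j 0) = string_arr C \<phi> 0 (coface (Suc j) 0)"
    using string_arr_collapse[of 0 "coface j 0"] string_arr_collapse[of 0 "coface (Suc j) 0"] le[of 0]
    by (simp add: collapse_coface)
  have last: "string_arr C \<phi> (coface j p) (Suc p) = string_arr C \<phi> (coface (Suc j) p) (Suc p)"
    using string_arr_collapse[of "coface j p" P] string_arr_collapse[of "coface (Suc j) p" P] le[of p] assms
    by (simp add: collapse_coface)
  have "pull C p (coface j) \<phi> = pull C p (coface (Suc j)) \<phi>"
    unfolding pull_def using arr obj by simp
  then show ?thesis unfolding face_term_def first last by simp
qed

end

lemma delta_S_reduced:
  assumes f: "f \<in> reduced_cochains p q"
  shows "delta_S p q f \<in> reduced_cochains (Suc p) q"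
  unfolding delta_S_face_term
proof (rule reduced_cochainI)
  fix \<phi> assume \<phi>: "\<phi> \<in> strings C (Suc p)"
  note ml = face_term_multilinear[OF reduced_cochain[OF f] \<phi>]
  show "multilinear K q (src \<phi>) (tgt \<phi>)
      (\<lambda>vs. \<Oplus>\<^bsub>tgt \<phi>\<^esub>i\<in>{0..Suc p}. [((-1) ^ i :: int)] \<cdot>\<^bsub>tgt \<phi>\<^esub> face_term p f i \<phi> vs)"
    by (intro multilinear_finsum multilinear_int_pow module_src[OF \<phi>] module_tgt[OF \<phi>] ml)
  fix vs assume "degenerate \<phi>" and vs: "vs \<in> tuples q (src \<phi>)"
  then obtain j x where j: "j < Suc p" and x: "x \<in> Obj C" "snd \<phi> ! j = Ident C x"
    using degenerateE[OF _ \<phi>] by metis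
  interpret Y: module K "tgt \<phi>" by (rule module_tgt[OF \<phi>])
  let ?t = "\<lambda>i. [((-1) ^ i :: int)] \<cdot>\<^bsub>tgt \<phi>\<^esub> face_term p f i \<phi> vs"
  have cl: "face_term p f i \<phi> vs \<in> carrier (tgt \<phi>)" for i
    by (rule multilinear_closed[OF ml vs])
  have zero: "?t i = \<zero>\<^bsub>tgt \<phi>\<^esub>" if i: "i \<le> Suc p" "i \<noteq> j" "i \<noteq> Suc j" for i
  proof -
    have "degenerate (pull C p (coface i) \<phi>)"
    \<comment> \<open>The coface skipping \<open>i\<close> takes the values \<open>j\<close> and
      \<open>j + 1\<close> at the consecutive arguments \<open>j - 1\<close> and \<open>j\<close> if
      \<open>i < j\<close>, and at \<open>j\<close> and \<open>j + 1\<close> themselves if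
      \<open>i > j + 1\<close>.\<close>
    proof (cases "i < j")
      case True
      then show ?thesis using j
        by (intro degenerate_pull[OF \<phi> j x, of "j - 1"]) (auto simp: coface_def)
    next
      case False
      then show ?thesis using j i
        by (intro degenerate_pull[OF \<phi> j x, of j]) (auto simp: coface_def)
    qed
    moreover have "pull C p (coface i) \<phi> \<in> strings C p"
      by (rule pull_strings[OF \<phi> mono_coface]) (simp add: coface_def)
    ultimately have "face_term p f i \<phi> vs = \<zero>\<^bsub>tgt \<phi>\<^esub>"
      using reduced_cochain_degenerate[OF f] by (intro face_term_zero[OF \<phi> vs])
    then show ?thesis by simp
  qed
  have "(\<Oplus>\<^bsub>tgt \<phi>\<^esub>i\<in>{0..Suc p}. ?t i) = (\<Oplus>\<^bsub>tgt \<phi>\<^esub>i\<in>{j, Suc j}. ?t i)"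
    by (rule Y.M.add.finprod_mono_neutral_cong_right) (use j zero cl in auto)
  also have "\<dots> = ?t j \<oplus>\<^bsub>tgt \<phi>\<^esub> ?t (Suc j)" using cl by simp
  also have "?t (Suc j) = \<ominus>\<^bsub>tgt \<phi>\<^esub> ?t j"
    using face_term_identity[OF \<phi> j x refl, of f vs] Y.M.add.int_pow_neg[OF cl, of "(-1) ^ j" j] by simp
  also have "?t j \<oplus>\<^bsub>tgt \<phi>\<^esub> (\<ominus>\<^bsub>tgt \<phi>\<^esub> ?t j) = \<zero>\<^bsub>tgt \<phi>\<^esub>" using cl by (simp add: Y.M.r_neg)
  finally show "(\<Oplus>\<^bsub>tgt \<phi>\<^esub>i\<in>{0..Suc p}. ?t i) = \<zero>\<^bsub>tgt \<phi>\<^esub>" .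
qed

text \<open>Ensures that the total differential keeps supports finite: components that were zero
  stay zero.\<close>

lemma delta_S_zero: "delta_S p q (zero_cochain p q) = zero_cochain (Suc p) q"
proof (rule cochain_eqI)
  show "delta_S p q (zero_cochain p q) \<in> cochains (Suc p) q"
    by (intro reduced_cochain delta_S_reduced zero_cochain_reduced)
  show "zero_cochain (Suc p) q \<in> cochains (Suc p) q"
    by (intro reduced_cochain zero_cochain_reduced)
  fix \<phi> vs assume \<phi>: "\<phi> \<in> strings C (Suc p)" and vs: "vs \<in> tuples q (src \<phi>)"
  interpret Y: module K "tgt \<phi>" by (rule module_tgt[OF \<phi>])
  have "face_term p (zero_cochain p q) i \<phi> vs = \<zero>\<^bsub>tgt \<phi>\<^esub>" for i
  proof (rule face_term_zero[OF \<phi> vs], rule zero_cochain_apply)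
    show "pull C p (coface i) \<phi> \<in> strings C p"
      by (rule pull_strings[OF \<phi> mono_coface]) (simp add: coface_def)
  qed
  then show "delta_S p q (zero_cochain p q) \<phi> vs = zero_cochain (Suc p) q \<phi> vs"
    using \<phi> vs by (simp add: delta_S_face_term zero_cochain_apply)
qed

end

section \<open>The operations of quilts\<close>

context vec_functor
begin

text \<open>Names the association list inside the recursion of \<open>compose_rose\<close>: the slot
  of each child, with the arity and the map substituted there. Its \<open>map_of\<close> plays the
  role of \<open>sub\<close> in the statements about \<open>fill_inputs\<close>.\<close>

definition subtree_slots ::
    "(nat \<Rightarrow> nat) \<Rightarrow> (nat \<Rightarrow> nat) \<Rightarrow> (nat \<Rightarrow> nat \<Rightarrow> nat) \<Rightarrow> (nat \<times> nat \<Rightarrow> nat) \<Rightarrow>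
     (nat \<Rightarrow> ('o, 'm, 'v) cochain) \<Rightarrow> 'o \<times> 'm list \<Rightarrow> nat \<Rightarrow> rose list \<Rightarrow> (nat \<times> nat \<times> ('v list \<Rightarrow> 'v)) list"
  where "subtree_slots p q \<zeta> I f \<phi> a ts = map (\<lambda>t. (I (a, label t), (num_inputs q t,
     \<lambda>ws. A (string_arr C \<phi> (\<zeta> a (p a)) (\<zeta> (label t) 0)) (compose_rose p q \<zeta> I f \<phi> t ws)))) ts"

lemma compose_rose_Vertex:
  "compose_rose p q \<zeta> I f \<phi> (Vertex a ts) vs =
     f a (pull C (p a) (\<zeta> a) \<phi>)
       (fill_inputs (map_of (subtree_slots p q \<zeta> I f \<phi> a ts))
         (A (string_arr C \<phi> (\<zeta> a (p a)) (length (snd \<phi>)))) [1..<Suc (q a)] vs)"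
  by (simp add: subtree_slots_def)

text \<open>The word enters composition along the tree only through \<open>mono\<close>,
  \<open>le\<close> and \<open>edge\<close>: each \<open>\<zeta> a\<close> is monotone with values
  in the string, and no edge goes back. These facts make all arrows involved well defined.\<close>

context
  fixes T p q \<zeta> I f \<phi> P
  assumes T: "is_tree T"
    and I: "I \<in> tree_colorings T q"
    and \<phi>: "\<phi> \<in> strings C P"
    and f: "\<And>a. a \<in> verts T \<Longrightarrow> f a \<in> cochains (p a) (q a)"
    and mono: "\<And>a. a \<in> verts T \<Longrightarrow> mono_on {0..p a} (\<zeta> a)"
    and le: "\<And>a. a \<in> verts T \<Longrightarrow> \<zeta> a (p a) \<le> P"
    and edge: "\<And>a b. (a, b) \<in> edges T \<Longrightarrow> \<zeta> a (p a) \<le> \<zeta> b 0"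
begin

lemma zeta_le: "a \<in> verts T \<Longrightarrow> i \<le> p a \<Longrightarrow> \<zeta> a i \<le> P"
  using mono_onD[OF mono, of a i "p a"] le[of a] by simp

lemma vertex_multilinear:
  assumes "a \<in> verts T"
  shows "multilinear K (q a) (V (string_obj C \<phi> (\<zeta> a (p a)))) (V (string_obj C \<phi> (\<zeta> a 0)))
    (f a (pull C (p a) (\<zeta> a) \<phi>))"
  using cochain_multilinear[OF f[OF assms] pull_strings[OF \<phi> mono[OF assms] le[OF assms]]]
    src_pull[OF \<phi> mono[OF assms] le[OF assms]] tgt_pull[OF \<phi> mono[OF assms] le[OF assms]] by simp

lemma free_input_linear:
  assumes "a \<in> verts T"
  shows "A (string_arr C \<phi> (\<zeta> a (p a)) (length (snd \<phi>)))
    \<in> linear_maps K (src \<phi>) (V (string_obj C \<phi> (\<zeta> a (p a))))"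
  using A_string_arr[OF \<phi> le[OF assms]] src_string[OF \<phi>] \<phi> by (simp add: strings_def)

lemma unfolds_child:
  assumes "unfolds T (Vertex a ts)" "t \<in> set ts"
  shows "(a, label t) \<in> edges T" "a \<in> verts T" "label t \<in> verts T" "unfolds T t"
proof -
  have "map label ts = child_list T a" using assms(1) by simp
  moreover have "label t \<in> set (map label ts)" using assms(2) by simp
  ultimately have "label t \<in> set (child_list T a)" by metis
  then show e: "(a, label t) \<in> edges T" using child_list[OF T, of a] by simp
  show "a \<in> verts T" "label t \<in> verts T" using edge_verts[OF T e] by auto
  show "unfolds T t" using assms by simp
qed

lemma edge_linear:
  assumes "(a, b) \<in> edges T"
  shows "A (string_arr C \<phi> (\<zeta> a (p a)) (\<zeta> b 0))
    \<in> linear_maps K (V (string_obj C \<phi> (\<zeta> b 0))) (V (string_obj C \<phi> (\<zeta> a (p a))))"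
  using A_string_arr[OF \<phi> edge[OF assms]] zeta_le[of b 0] edge_verts[OF T assms] by simp

lemma subtree_slots_arity:
  assumes "unfolds T (Vertex a ts)"
  shows "(\<Sum>i\<leftarrow>[1..<Suc (q a)]. slot_arity (map_of (subtree_slots p q \<zeta> I f \<phi> a ts)) i) = num_inputs q (Vertex a ts)"
    and "distinct (map fst (subtree_slots p q \<zeta> I f \<phi> a ts))"
proof -
  let ?S = "subtree_slots p q \<zeta> I f \<phi> a ts"
  note cs = coloring_slots[OF T I assms]
  show d: "distinct (map fst ?S)" using cs(1) by (simp add: subtree_slots_def comp_def)
  have "fst ` set ?S \<subseteq> {1..q a}" using cs(2) by (auto simp: subtree_slots_def)
  also have "{1..q a} = set [1..<Suc (q a)]" by auto
  finally have s: "fst ` set ?S \<subseteq> set [1..<Suc (q a)]" .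
  have "(\<Sum>i\<leftarrow>[1..<Suc (q a)]. slot_arity (map_of ?S) i)
    = (length [1..<Suc (q a)] - length ?S) + (\<Sum>s\<leftarrow>?S. fst (snd s))"
    by (rule sum_slot_arity[OF _ d s]) simp
  then show "(\<Sum>i\<leftarrow>[1..<Suc (q a)]. slot_arity (map_of ?S) i) = num_inputs q (Vertex a ts)"
    by (simp add: subtree_slots_def comp_def del: upt_Suc)
qed

lemma subtree_slots_multilinear:
  assumes "unfolds T (Vertex a ts)"
    and "\<And>t. t \<in> set ts \<Longrightarrow> multilinear K (num_inputs q t) (src \<phi>) (V (string_obj C \<phi> (\<zeta> (label t) 0)))
      (compose_rose p q \<zeta> I f \<phi> t)"
    and "map_of (subtree_slots p q \<zeta> I f \<phi> a ts) i = Some (m, h)"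
  shows "multilinear K m (src \<phi>) (V (string_obj C \<phi> (\<zeta> a (p a)))) h"
proof -
  obtain t where t: "t \<in> set ts" "m = num_inputs q t"
    "h = (\<lambda>ws. A (string_arr C \<phi> (\<zeta> a (p a)) (\<zeta> (label t) 0)) (compose_rose p q \<zeta> I f \<phi> t ws))"
    using map_of_SomeD[OF assms(3)] by (auto simp: subtree_slots_def)
  show ?thesis unfolding t(2,3)
    by (rule multilinear_postcomp[OF assms(2)[OF t(1)] edge_linear[OF unfolds_child(1)[OF assms(1) t(1)]]])
qed

text \<open>Structural induction: by \<open>fill_inputs_update\<close> each input enters one
  argument of the vertex map, and enters it linearly. The target is taken at
  \<open>\<zeta> (label t) 0\<close> because the map along the edge above, or into the start of the
  string, is applied only afterwards.\<close>

lemma compose_rose_multilinear: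
  "unfolds T t \<Longrightarrow> multilinear K (num_inputs q t) (src \<phi>) (V (string_obj C \<phi> (\<zeta> (label t) 0)))
    (compose_rose p q \<zeta> I f \<phi> t)"
proof (induction t)
  case (Vertex a ts)
  have a: "a \<in> verts T" using Vertex.prems by simp
  let ?sub = "map_of (subtree_slots p q \<zeta> I f \<phi> a ts)"
  let ?g = "A (string_arr C \<phi> (\<zeta> a (p a)) (length (snd \<phi>)))"
  let ?F = "fill_inputs ?sub ?g [1..<Suc (q a)]"
  have sub: "multilinear K m (src \<phi>) (V (string_obj C \<phi> (\<zeta> a (p a)))) h" if "?sub i = Some (m, h)" for i m h
    by (rule subtree_slots_multilinear[OF Vertex.prems _ that]) (use Vertex in auto)
  have F: "?F vs \<in> tuples (q a) (V (string_obj C \<phi> (\<zeta> a (p a))))"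
    if "vs \<in> tuples (num_inputs q (Vertex a ts)) (src \<phi>)" for vs
    using fill_inputs_tuples[OF free_input_linear[OF a], of "[1..<Suc (q a)]" ?sub vs] sub that
    unfolding subtree_slots_arity(1)[OF Vertex.prems] by (simp del: upt_Suc)
  have "\<exists>i<q a. \<exists>h\<in>linear_maps K (src \<phi>) (V (string_obj C \<phi> (\<zeta> a (p a)))).
      \<forall>u\<in>carrier (src \<phi>). ?F (vs[j := u]) = (?F vs)[i := h u]"
    if "vs \<in> tuples (num_inputs q (Vertex a ts)) (src \<phi>)" "j < num_inputs q (Vertex a ts)" for vs j
  proof -
    have "j < length vs" using that by (simp add: tuples_def del: num_inputs.simps)
    then show ?thesis
      using fill_inputs_update[OF free_input_linear[OF a], of "[1..<Suc (q a)]" ?sub vs j] sub that(1)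
      unfolding subtree_slots_arity(1)[OF Vertex.prems] by (simp del: upt_Suc num_inputs.simps)
  qed
  from multilinear_precomp[OF vertex_multilinear[OF a] F this module_src[OF \<phi>]]
  show ?case unfolding compose_rose_Vertex by (simp del: num_inputs.simps upt_Suc)
qed

text \<open>The zero produced at \<open>b\<close> travels towards the root: the linear map along
  each edge preserves it, and in the parent it is one entry of a multilinear map.\<close>

lemma compose_rose_zero:
  assumes b: "\<And>ws. ws \<in> tuples (q b) (V (string_obj C \<phi> (\<zeta> b (p b)))) \<Longrightarrow>
      f b (pull C (p b) (\<zeta> b) \<phi>) ws = \<zero>\<^bsub>V (string_obj C \<phi> (\<zeta> b 0))\<^esub>"
  shows "unfolds T t \<Longrightarrow> b \<in> set (rose_vertices t) \<Longrightarrow> vs \<in> tuples (num_inputs q t) (src \<phi>) \<Longrightarrow>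
    compose_rose p q \<zeta> I f \<phi> t vs = \<zero>\<^bsub>V (string_obj C \<phi> (\<zeta> (label t) 0))\<^esub>"
proof (induction t arbitrary: vs)
  case (Vertex a ts)
  have a: "a \<in> verts T" using Vertex.prems by simp
  let ?S = "subtree_slots p q \<zeta> I f \<phi> a ts"
  let ?g = "A (string_arr C \<phi> (\<zeta> a (p a)) (length (snd \<phi>)))"
  let ?Y = "V (string_obj C \<phi> (\<zeta> a (p a)))"
  let ?F = "fill_inputs (map_of ?S) ?g [1..<Suc (q a)]"
  note arity = subtree_slots_arity[OF Vertex.prems(1)]
  have sub: "multilinear K m (src \<phi>) ?Y h" if "map_of ?S i = Some (m, h)" for i m h
    by (rule subtree_slots_multilinear[OF Vertex.prems(1) _ that])
      (use compose_rose_multilinear unfolds_child(4)[OF Vertex.prems(1)] in blast)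
  have vs: "vs \<in> tuples (\<Sum>i\<leftarrow>[1..<Suc (q a)]. slot_arity (map_of ?S) i) (src \<phi>)"
    using Vertex.prems(3) unfolding arity(1) .
  have F: "?F vs \<in> tuples (q a) ?Y"
    using fill_inputs_tuples[OF free_input_linear[OF a] _ vs] sub by (simp del: upt_Suc)
  show ?case
  proof (cases "b = a")
    case True
    then show ?thesis using b F by (simp add: compose_rose_Vertex del: compose_rose.simps upt_Suc)
  next
    case False
    then obtain t where t: "t \<in> set ts" "b \<in> set (rose_vertices t)" using Vertex.prems(2) by auto
    note ch = unfolds_child[OF Vertex.prems(1) t(1)]
    let ?h = "\<lambda>ws. A (string_arr C \<phi> (\<zeta> a (p a)) (\<zeta> (label t) 0)) (compose_rose p q \<zeta> I f \<phi> t ws)"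
    \<comment> \<open>Siblings have distinct slots, so the lookup returns this subtree and not an
      earlier entry with the same key.\<close>
    have lookup: "map_of ?S (I (a, label t)) = Some (num_inputs q t, ?h)"
      by (rule map_of_is_SomeI[OF arity(2)]) (use t(1) in \<open>auto simp: subtree_slots_def\<close>)
    have modY: "module K ?Y" by (rule module_string[OF \<phi> le[OF a]])
    have modt: "module K (V (string_obj C \<phi> (\<zeta> (label t) 0)))"
      by (rule module_string[OF \<phi> zeta_le[OF ch(3)]]) simp
    have h0: "?h ws = \<zero>\<^bsub>?Y\<^esub>" if "ws \<in> tuples (num_inputs q t) (src \<phi>)" for ws
      using Vertex.IH[OF t(1) ch(4) t(2) that] linear_maps_zero[OF modt modY edge_linear[OF ch(1)]] by simp
    have mem: "I (a, label t) \<in> set [1..<Suc (q a)]"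
    proof -
      have "I (a, label t) \<in> {1..q a}" using coloring_slots(2)[OF T I Vertex.prems(1)] t(1) by blast
      then show ?thesis by auto
    qed
    obtain i where i: "i < q a" "?F vs ! i = \<zero>\<^bsub>?Y\<^esub>"
      using fill_inputs_zero[where g = ?g, OF vs mem lookup h0] by (auto simp del: upt_Suc)
    have modr: "module K (V (string_obj C \<phi> (\<zeta> a 0)))"
      by (rule module_string[OF \<phi> zeta_le[OF a]]) simp
    show ?thesis
      using multilinear_zero_entry[OF modY modr vertex_multilinear[OF a] F i]
      by (simp add: compose_rose_Vertex del: compose_rose.simps upt_Suc)
  qed
qed

lemma root_map_linear:
  "A (string_arr C \<phi> 0 (\<zeta> (label (rose_of T)) 0))
    \<in> linear_maps K (V (string_obj C \<phi> (\<zeta> (label (rose_of T)) 0))) (tgt \<phi>)"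
  "\<zeta> (label (rose_of T)) 0 \<le> P"
proof -
  have "label (rose_of T) \<in> verts T"
    using rose_of_unfolds[OF T] by (cases "rose_of T") auto
  then show le: "\<zeta> (label (rose_of T)) 0 \<le> P" by (rule zeta_le) simp
  show "A (string_arr C \<phi> 0 (\<zeta> (label (rose_of T)) 0))
    \<in> linear_maps K (V (string_obj C \<phi> (\<zeta> (label (rose_of T)) 0))) (tgt \<phi>)"
    using A_string_arr[OF \<phi> _ le, of 0] by (simp add: tgt_def)
qed

lemma coloring_action_multilinear:
  "multilinear K (num_inputs q (rose_of T)) (src \<phi>) (tgt \<phi>) (coloring_action T p q \<zeta> I f \<phi>)"
  using multilinear_postcomp[OF compose_rose_multilinear[OF rose_of_unfolds[OF T]] root_map_linear(1)]
  unfolding coloring_action_def .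

lemma coloring_action_zero:
  assumes "b \<in> verts T"
    and "\<And>ws. ws \<in> tuples (q b) (V (string_obj C \<phi> (\<zeta> b (p b)))) \<Longrightarrow>
      f b (pull C (p b) (\<zeta> b) \<phi>) ws = \<zero>\<^bsub>V (string_obj C \<phi> (\<zeta> b 0))\<^esub>"
    and "vs \<in> tuples (num_inputs q (rose_of T)) (src \<phi>)"
  shows "coloring_action T p q \<zeta> I f \<phi> vs = \<zero>\<^bsub>tgt \<phi>\<^esub>"
proof -
  have "b \<in> set (rose_vertices (rose_of T))" using assms(1) set_rose_vertices[OF T] by simp
  from compose_rose_zero[OF assms(2) rose_of_unfolds[OF T] this assms(3)]
  show ?thesis
    using linear_maps_zero[OF module_string[OF \<phi> root_map_linear(2)] module_tgt[OF \<phi>] root_map_linear(1)]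
    by (simp add: coloring_action_def)
qed

end

text \<open>Reconciles the arity found by recursion on the rose tree with the arity declared for the
  output; the integer identity behind it also shows that \<open>out_q n q\<close> is nonnegative
  once a coloring exists.\<close>

lemma num_inputs_rose_of:
  assumes "is_tree T" "verts T = {1..n}" "I \<in> tree_colorings T q"
  shows "num_inputs q (rose_of T) = nat (out_q n q)"
proof -
  have "(\<Sum>a\<leftarrow>rose_vertices (rose_of T). int (q a) - 1) = (\<Sum>a\<in>{1..n}. int (q a) - 1)"
    using set_rose_vertices[OF assms(1)] distinct_rose_vertices[OF assms(1)] assms(2)
    by (simp add: sum_list_distinct_conv_sum_set)
  then have "int (num_inputs q (rose_of T)) = out_q n q"
    using num_inputs_unfolds[OF assms(1,3) rose_of_unfolds[OF assms(1)]] by (simp add: out_q_def)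
  then show ?thesis by linarith
qed

lemma quilt_op_reduced:
  assumes Q: "Q \<in> Quilt n" and f: "\<And>a. a \<in> {1..n} \<Longrightarrow> f a \<in> reduced_cochains (p a) (q a)"
  shows "quilt_op n Q p q f \<in> reduced_cochains (out_p n (fst Q) p) (nat (out_q n q))"
proof -
  obtain W T where WT: "Q = (W, T)" by force
  have W: "W \<in> F2S n" and T: "is_tree T" "verts T = {1..n}"
    using Q unfolding WT by (auto simp: Quilt_def Tree_def)
  have fc: "f a \<in> cochains (p a) (q a)" if "a \<in> verts T" for a
    using reduced_cochain[OF f] that T(2) by simp
  have mono: "mono_on {0..p a} (\<zeta> a)" if "\<zeta> \<in> word_colorings n W p" "a \<in> verts T" for \<zeta> a
    using word_coloring_strict_mono[OF that(1)] that(2) T(2) strict_mono_on_imp_mono_on by blast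
  have le: "\<zeta> a (p a) \<le> out_p n W p" if "\<zeta> \<in> word_colorings n W p" "a \<in> verts T" for \<zeta> a
    using word_coloring_le[OF that(1)] that(2) T(2) by simp
  note edge = quilt_coloring_edge[OF Q[unfolded WT]]
  show ?thesis unfolding quilt_op_def
  proof (rule reduced_cochainI)
    fix \<phi> assume "\<phi> \<in> strings C (out_p n (fst Q) p)"
    then have \<phi>: "\<phi> \<in> strings C (out_p n W p)" by (simp add: WT)
    have ml: "multilinear K (nat (out_q n q)) (src \<phi>) (tgt \<phi>) (coloring_action T p q \<zeta> I f \<phi>)"
      if "\<zeta> \<in> word_colorings n W p" "I \<in> tree_colorings T q" for \<zeta> I
      using coloring_action_multilinear[OF T(1) that(2) \<phi> fc mono[OF that(1)] le[OF that(1)] edge[OF that(1)]]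
      unfolding num_inputs_rose_of[OF T that(2)] .
    show "multilinear K (nat (out_q n q)) (src \<phi>) (tgt \<phi>) (\<lambda>vs.
        \<Oplus>\<^bsub>tgt \<phi>\<^esub>\<zeta>\<in>word_colorings n (fst Q) p. \<Oplus>\<^bsub>tgt \<phi>\<^esub>I\<in>tree_colorings (snd Q) q.
          [quilt_sgn n Q p q \<zeta> I] \<cdot>\<^bsub>tgt \<phi>\<^esub> coloring_action (snd Q) p q \<zeta> I f \<phi> vs)"
      unfolding WT fst_conv snd_conv
      by (intro multilinear_finsum multilinear_int_pow module_src[OF \<phi>] module_tgt[OF \<phi>] ml)
    fix vs assume "degenerate \<phi>" and vs: "vs \<in> tuples (nat (out_q n q)) (src \<phi>)"
    then obtain j x where jx: "j < out_p n W p" "x \<in> Obj C" "snd \<phi> ! j = Ident C x"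
      using degenerateE[OF _ \<phi>] by metis
    interpret Y: module K "tgt \<phi>" by (rule module_tgt[OF \<phi>])
    have "coloring_action T p q \<zeta> I f \<phi> vs = \<zero>\<^bsub>tgt \<phi>\<^esub>"
      if zI: "\<zeta> \<in> word_colorings n W p" "I \<in> tree_colorings T q" for \<zeta> I
    proof -
      obtain b i where b: "b \<in> {1..n}" "i < p b" "\<zeta> b i = j" "\<zeta> b (Suc i) = Suc j"
        using word_coloring_step[OF W zI(1) jx(1)] by blast
      have bv: "b \<in> verts T" using b(1) T(2) by simp
      note pull = \<phi> mono[OF zI(1) bv] le[OF zI(1) bv]
      have deg: "degenerate (pull C (p b) (\<zeta> b) \<phi>)"
        by (rule degenerate_pull[OF \<phi> jx b(2-4)])
      have f0: "f b (pull C (p b) (\<zeta> b) \<phi>) ws = \<zero>\<^bsub>V (string_obj C \<phi> (\<zeta> b 0))\<^esub>"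
        if "ws \<in> tuples (q b) (V (string_obj C \<phi> (\<zeta> b (p b))))" for ws
        using reduced_cochain_degenerate[OF f[OF b(1)] pull_strings[OF pull] deg] that
        unfolding src_pull[OF pull] tgt_pull[OF pull] by blast
      have "vs \<in> tuples (num_inputs q (rose_of T)) (src \<phi>)"
        using vs unfolding num_inputs_rose_of[OF T zI(2)] .
      from coloring_action_zero[OF T(1) zI(2) \<phi> fc mono[OF zI(1)] le[OF zI(1)] edge[OF zI(1)] bv f0 this]
      show ?thesis .
    qed
    then show "(\<Oplus>\<^bsub>tgt \<phi>\<^esub>\<zeta>\<in>word_colorings n (fst Q) p. \<Oplus>\<^bsub>tgt \<phi>\<^esub>I\<in>tree_colorings (snd Q) q.
          [quilt_sgn n Q p q \<zeta> I] \<cdot>\<^bsub>tgt \<phi>\<^esub> coloring_action (snd Q) p q \<zeta> I f \<phi> vs) = \<zero>\<^bsub>tgt \<phi>\<^esub>"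
      unfolding WT fst_conv snd_conv by (intro Y.M.add.finprod_one_eqI) simp
  qed
qed

section \<open>The total module\<close>

abbreviation "M \<equiv> total_module"

lemma total_carrier:
  "F \<in> carrier M \<longleftrightarrow> (\<forall>p q. F p q \<in> cochains p q) \<and> finite {(p, q). F p q \<noteq> zero_cochain p q}"
  by (simp add: total_module_def)

lemma total_zero: "\<zero>\<^bsub>M\<^esub> = zero_cochain"
  by (simp add: total_module_def)

lemma total_add: "(F \<oplus>\<^bsub>M\<^esub> G) p q =
    (\<lambda>\<phi>\<in>strings C p. \<lambda>vs\<in>tuples q (src \<phi>). F p q \<phi> vs \<oplus>\<^bsub>tgt \<phi>\<^esub> G p q \<phi> vs)"
  by (simp add: total_module_def)

lemma total_smult: "(c \<odot>\<^bsub>M\<^esub> F) p q =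
    (\<lambda>\<phi>\<in>strings C p. \<lambda>vs\<in>tuples q (src \<phi>). c \<odot>\<^bsub>tgt \<phi>\<^esub> F p q \<phi> vs)"
  by (simp add: total_module_def)

lemma total_value_closed:
  "F \<in> carrier M \<Longrightarrow> \<phi> \<in> strings C p \<Longrightarrow> vs \<in> tuples q (src \<phi>) \<Longrightarrow> F p q \<phi> vs \<in> carrier (tgt \<phi>)"
  using multilinear_closed[OF cochain_multilinear, of "F p q" p q \<phi> vs] by (simp add: total_carrier)

text \<open>Reduces each module axiom for the total space to the same axiom for the values in the
  module \<open>tgt \<phi>\<close>.\<close>

lemma total_eqI:
  assumes "F \<in> carrier M" "G \<in> carrier M"
    and "\<And>p q \<phi> vs. \<phi> \<in> strings C p \<Longrightarrow> vs \<in> tuples q (src \<phi>) \<Longrightarrow> F p q \<phi> vs = G p q \<phi> vs"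
  shows "F = G"
proof (rule ext, rule ext)
  fix p q
  show "F p q = G p q" by (rule cochain_eqI) (use assms in \<open>auto simp: total_carrier\<close>)
qed

lemma cochain_add_closed:
  assumes "f \<in> cochains p q" "g \<in> cochains p q"
  shows "(\<lambda>\<phi>\<in>strings C p. \<lambda>vs\<in>tuples q (src \<phi>). f \<phi> vs \<oplus>\<^bsub>tgt \<phi>\<^esub> g \<phi> vs) \<in> cochains p q"
  by (rule cochainI, rule multilinear_add[OF module_src module_tgt
      cochain_multilinear[OF assms(1)] cochain_multilinear[OF assms(2)]])

lemma cochain_smult_closed:
  assumes "f \<in> cochains p q" "c \<in> carrier K"
  shows "(\<lambda>\<phi>\<in>strings C p. \<lambda>vs\<in>tuples q (src \<phi>). c \<odot>\<^bsub>tgt \<phi>\<^esub> f \<phi> vs) \<in> cochains p q"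
  by (rule cochainI, rule multilinear_smult[OF module_src module_tgt cochain_multilinear[OF assms(1)] assms(2)])

lemma total_add_closed:
  assumes "F \<in> carrier M" "G \<in> carrier M"
  shows "F \<oplus>\<^bsub>M\<^esub> G \<in> carrier M"
  unfolding total_carrier
proof (intro conjI allI)
  show "(F \<oplus>\<^bsub>M\<^esub> G) p q \<in> cochains p q" for p q
    unfolding total_add by (rule cochain_add_closed) (use assms in \<open>auto simp: total_carrier\<close>)
  have "(F \<oplus>\<^bsub>M\<^esub> G) p q = zero_cochain p q"
    if "F p q = zero_cochain p q" "G p q = zero_cochain p q" for p q
  proof (rule cochain_eqI)
    fix \<phi> vs assume \<phi>: "\<phi> \<in> strings C p" and vs: "vs \<in> tuples q (src \<phi>)"
    interpret Y: module K "tgt \<phi>" by (rule module_tgt[OF \<phi>])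
    show "(F \<oplus>\<^bsub>M\<^esub> G) p q \<phi> vs = zero_cochain p q \<phi> vs"
      using \<phi> vs that by (simp add: total_add zero_cochain_apply)
  qed (use \<open>\<And>q p. (F \<oplus>\<^bsub>M\<^esub> G) p q \<in> cochains p q\<close> reduced_cochain[OF zero_cochain_reduced] in auto)
  then have "{(p, q). (F \<oplus>\<^bsub>M\<^esub> G) p q \<noteq> zero_cochain p q}
    \<subseteq> {(p, q). F p q \<noteq> zero_cochain p q} \<union> {(p, q). G p q \<noteq> zero_cochain p q}" by auto
  then show "finite {(p, q). (F \<oplus>\<^bsub>M\<^esub> G) p q \<noteq> zero_cochain p q}"
    by (rule finite_subset) (use assms in \<open>auto simp: total_carrier\<close>)
qed

lemma total_smult_closed:
  assumes "F \<in> carrier M" "c \<in> carrier K"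
  shows "c \<odot>\<^bsub>M\<^esub> F \<in> carrier M"
  unfolding total_carrier
proof (intro conjI allI)
  show "(c \<odot>\<^bsub>M\<^esub> F) p q \<in> cochains p q" for p q
    unfolding total_smult by (rule cochain_smult_closed) (use assms in \<open>auto simp: total_carrier\<close>)
  have "(c \<odot>\<^bsub>M\<^esub> F) p q = zero_cochain p q" if "F p q = zero_cochain p q" for p q
  proof (rule cochain_eqI)
    fix \<phi> vs assume \<phi>: "\<phi> \<in> strings C p" and vs: "vs \<in> tuples q (src \<phi>)"
    interpret Y: module K "tgt \<phi>" by (rule module_tgt[OF \<phi>])
    show "(c \<odot>\<^bsub>M\<^esub> F) p q \<phi> vs = zero_cochain p q \<phi> vs"
      using \<phi> vs that assms(2) by (simp add: total_smult zero_cochain_apply)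
  qed (use \<open>\<And>q p. (c \<odot>\<^bsub>M\<^esub> F) p q \<in> cochains p q\<close> reduced_cochain[OF zero_cochain_reduced] in auto)
  then have "{(p, q). (c \<odot>\<^bsub>M\<^esub> F) p q \<noteq> zero_cochain p q} \<subseteq> {(p, q). F p q \<noteq> zero_cochain p q}" by auto
  then show "finite {(p, q). (c \<odot>\<^bsub>M\<^esub> F) p q \<noteq> zero_cochain p q}"
    by (rule finite_subset) (use assms in \<open>auto simp: total_carrier\<close>)
qed

lemma total_zero_closed: "\<zero>\<^bsub>M\<^esub> \<in> carrier M"
  using reduced_cochain[OF zero_cochain_reduced] by (simp add: total_carrier total_zero)

lemma total_value_module:
  assumes "\<phi> \<in> strings C p" "vs \<in> tuples q (src \<phi>)"
  shows "(F \<oplus>\<^bsub>M\<^esub> G) p q \<phi> vs = F p q \<phi> vs \<oplus>\<^bsub>tgt \<phi>\<^esub> G p q \<phi> vs"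
    and "(c \<odot>\<^bsub>M\<^esub> F) p q \<phi> vs = c \<odot>\<^bsub>tgt \<phi>\<^esub> F p q \<phi> vs"
    and "\<zero>\<^bsub>M\<^esub> p q \<phi> vs = \<zero>\<^bsub>tgt \<phi>\<^esub>"
  using assms by (simp_all add: total_add total_smult total_zero zero_cochain_apply)

lemma module_total: "module K M"
proof (rule moduleI)
  show "abelian_group M"
  proof (rule abelian_groupI)
    fix F G H assume F: "F \<in> carrier M" and G: "G \<in> carrier M" and H: "H \<in> carrier M"
    show "(F \<oplus>\<^bsub>M\<^esub> G) \<oplus>\<^bsub>M\<^esub> H = F \<oplus>\<^bsub>M\<^esub> (G \<oplus>\<^bsub>M\<^esub> H)"
    proof (rule total_eqI)
      fix p q \<phi> vs assume \<phi>: "\<phi> \<in> strings C p" and vs: "vs \<in> tuples q (src \<phi>)"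
      interpret Y: module K "tgt \<phi>" by (rule module_tgt[OF \<phi>])
      show "((F \<oplus>\<^bsub>M\<^esub> G) \<oplus>\<^bsub>M\<^esub> H) p q \<phi> vs = (F \<oplus>\<^bsub>M\<^esub> (G \<oplus>\<^bsub>M\<^esub> H)) p q \<phi> vs"
        using total_value_closed[OF _ \<phi> vs] F G H by (simp add: total_value_module[OF \<phi> vs] Y.M.a_assoc)
    qed (intro total_add_closed F G H)+
  next
    fix F G assume F: "F \<in> carrier M" and G: "G \<in> carrier M"
    show "F \<oplus>\<^bsub>M\<^esub> G = G \<oplus>\<^bsub>M\<^esub> F"
    proof (rule total_eqI)
      fix p q \<phi> vs assume \<phi>: "\<phi> \<in> strings C p" and vs: "vs \<in> tuples q (src \<phi>)"
      interpret Y: module K "tgt \<phi>" by (rule module_tgt[OF \<phi>])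
      show "(F \<oplus>\<^bsub>M\<^esub> G) p q \<phi> vs = (G \<oplus>\<^bsub>M\<^esub> F) p q \<phi> vs"
        using total_value_closed[OF _ \<phi> vs] F G by (simp add: total_value_module[OF \<phi> vs] Y.M.a_comm)
    qed (intro total_add_closed F G)+
  next
    fix F assume F: "F \<in> carrier M"
    show "\<zero>\<^bsub>M\<^esub> \<oplus>\<^bsub>M\<^esub> F = F"
    proof (rule total_eqI)
      fix p q \<phi> vs assume \<phi>: "\<phi> \<in> strings C p" and vs: "vs \<in> tuples q (src \<phi>)"
      interpret Y: module K "tgt \<phi>" by (rule module_tgt[OF \<phi>])
      show "(\<zero>\<^bsub>M\<^esub> \<oplus>\<^bsub>M\<^esub> F) p q \<phi> vs = F p q \<phi> vs"
        using total_value_closed[OF _ \<phi> vs] F by (simp add: total_value_module[OF \<phi> vs])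
    qed (intro total_add_closed total_zero_closed F)+
  next
    fix F assume F: "F \<in> carrier M"
    \<comment> \<open>The additive inverse is taken to be the multiple by minus one, whose closure
      and finite support are then already known.\<close>
    have neg: "(\<ominus>\<^bsub>K\<^esub> \<one>\<^bsub>K\<^esub>) \<odot>\<^bsub>M\<^esub> F \<in> carrier M" by (intro total_smult_closed F) simp
    have "(\<ominus>\<^bsub>K\<^esub> \<one>\<^bsub>K\<^esub>) \<odot>\<^bsub>M\<^esub> F \<oplus>\<^bsub>M\<^esub> F = \<zero>\<^bsub>M\<^esub>"
    proof (rule total_eqI)
      fix p q \<phi> vs assume \<phi>: "\<phi> \<in> strings C p" and vs: "vs \<in> tuples q (src \<phi>)"
      interpret Y: module K "tgt \<phi>" by (rule module_tgt[OF \<phi>])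
      show "((\<ominus>\<^bsub>K\<^esub> \<one>\<^bsub>K\<^esub>) \<odot>\<^bsub>M\<^esub> F \<oplus>\<^bsub>M\<^esub> F) p q \<phi> vs = \<zero>\<^bsub>M\<^esub> p q \<phi> vs"
        using total_value_closed[OF F \<phi> vs]
        by (simp add: total_value_module[OF \<phi> vs] Y.smult_l_minus Y.M.l_neg)
    qed (intro total_add_closed total_zero_closed neg F)+
    then show "\<exists>G\<in>carrier M. G \<oplus>\<^bsub>M\<^esub> F = \<zero>\<^bsub>M\<^esub>" using neg by blast
  qed (intro total_add_closed total_zero_closed; assumption)+
next
  fix a b F G assume a: "a \<in> carrier K" and b: "b \<in> carrier K" and F: "F \<in> carrier M" and G: "G \<in> carrier M"
  show "(a \<oplus>\<^bsub>K\<^esub> b) \<odot>\<^bsub>M\<^esub> F = a \<odot>\<^bsub>M\<^esub> F \<oplus>\<^bsub>M\<^esub> b \<odot>\<^bsub>M\<^esub> F"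
  proof (rule total_eqI)
    fix p q \<phi> vs assume \<phi>: "\<phi> \<in> strings C p" and vs: "vs \<in> tuples q (src \<phi>)"
    interpret Y: module K "tgt \<phi>" by (rule module_tgt[OF \<phi>])
    show "((a \<oplus>\<^bsub>K\<^esub> b) \<odot>\<^bsub>M\<^esub> F) p q \<phi> vs = (a \<odot>\<^bsub>M\<^esub> F \<oplus>\<^bsub>M\<^esub> b \<odot>\<^bsub>M\<^esub> F) p q \<phi> vs"
      using total_value_closed[OF F \<phi> vs] a b by (simp add: total_value_module[OF \<phi> vs] Y.smult_l_distr)
  qed (intro total_add_closed total_smult_closed K.add.m_closed a b F)+
  show "a \<odot>\<^bsub>M\<^esub> (F \<oplus>\<^bsub>M\<^esub> G) = a \<odot>\<^bsub>M\<^esub> F \<oplus>\<^bsub>M\<^esub> a \<odot>\<^bsub>M\<^esub> G"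
  proof (rule total_eqI)
    fix p q \<phi> vs assume \<phi>: "\<phi> \<in> strings C p" and vs: "vs \<in> tuples q (src \<phi>)"
    interpret Y: module K "tgt \<phi>" by (rule module_tgt[OF \<phi>])
    show "(a \<odot>\<^bsub>M\<^esub> (F \<oplus>\<^bsub>M\<^esub> G)) p q \<phi> vs = (a \<odot>\<^bsub>M\<^esub> F \<oplus>\<^bsub>M\<^esub> a \<odot>\<^bsub>M\<^esub> G) p q \<phi> vs"
      using total_value_closed[OF _ \<phi> vs] a F G by (simp add: total_value_module[OF \<phi> vs] Y.smult_r_distr)
  qed (intro total_add_closed total_smult_closed a F G)+
  show "(a \<otimes>\<^bsub>K\<^esub> b) \<odot>\<^bsub>M\<^esub> F = a \<odot>\<^bsub>M\<^esub> (b \<odot>\<^bsub>M\<^esub> F)"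
  proof (rule total_eqI)
    fix p q \<phi> vs assume \<phi>: "\<phi> \<in> strings C p" and vs: "vs \<in> tuples q (src \<phi>)"
    interpret Y: module K "tgt \<phi>" by (rule module_tgt[OF \<phi>])
    show "((a \<otimes>\<^bsub>K\<^esub> b) \<odot>\<^bsub>M\<^esub> F) p q \<phi> vs = (a \<odot>\<^bsub>M\<^esub> (b \<odot>\<^bsub>M\<^esub> F)) p q \<phi> vs"
      using total_value_closed[OF F \<phi> vs] a b by (simp add: total_value_module[OF \<phi> vs] Y.smult_assoc1)
  qed (intro total_smult_closed K.m_closed a b F)+
next
  fix F assume F: "F \<in> carrier M"
  show "\<one>\<^bsub>K\<^esub> \<odot>\<^bsub>M\<^esub> F = F"
  proof (rule total_eqI)
    fix p q \<phi> vs assume \<phi>: "\<phi> \<in> strings C p" and vs: "vs \<in> tuples q (src \<phi>)"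
    interpret Y: module K "tgt \<phi>" by (rule module_tgt[OF \<phi>])
    show "(\<one>\<^bsub>K\<^esub> \<odot>\<^bsub>M\<^esub> F) p q \<phi> vs = F p q \<phi> vs"
      using total_value_closed[OF F \<phi> vs] by (simp add: total_value_module[OF \<phi> vs])
  qed (intro total_smult_closed K.one_closed F)+
qed (rule K.is_cring, rule total_smult_closed)

section \<open>Closure of the reduced subspace under all the structure\<close>

lemma total_reduced_iff:
  "F \<in> total_reduced \<longleftrightarrow> (\<forall>p q. F p q \<in> reduced_cochains p q) \<and> finite {(p, q). F p q \<noteq> zero_cochain p q}"
  using reduced_cochain unfolding total_reduced_def total_carrier by blast

lemma submodule_total_reduced: "submodule total_reduced K M"
proof -
  interpret M: module K M by (rule module_total)
  have sub: "F \<in> carrier M" if "F \<in> total_reduced" for F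
    using that unfolding total_reduced_def by blast
  have red: "F p q \<in> reduced_cochains p q" if "F \<in> total_reduced" for F p q
    using that unfolding total_reduced_def by blast
  have smult: "c \<odot>\<^bsub>M\<^esub> F \<in> total_reduced" if c: "c \<in> carrier K" and F: "F \<in> total_reduced" for c F
  proof -
    have "(c \<odot>\<^bsub>M\<^esub> F) p q \<in> reduced_cochains p q" for p q
      unfolding total_smult
    proof (rule reduced_cochainI)
      fix \<phi> assume \<phi>: "\<phi> \<in> strings C p"
      show "multilinear K q (src \<phi>) (tgt \<phi>) (\<lambda>vs. c \<odot>\<^bsub>tgt \<phi>\<^esub> F p q \<phi> vs)"
        by (rule multilinear_smult[OF module_src[OF \<phi>] module_tgt[OF \<phi>]
              cochain_multilinear[OF reduced_cochain[OF red[OF F]] \<phi>] c])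
      interpret Y: module K "tgt \<phi>" by (rule module_tgt[OF \<phi>])
      show "c \<odot>\<^bsub>tgt \<phi>\<^esub> F p q \<phi> vs = \<zero>\<^bsub>tgt \<phi>\<^esub>" if "degenerate \<phi>" "vs \<in> tuples q (src \<phi>)" for vs
        using reduced_cochain_degenerate[OF red[OF F] \<phi> that] c by simp
    qed
    then show ?thesis using total_smult_closed[OF sub[OF F] c] unfolding total_reduced_def by blast
  qed
  show ?thesis
  proof (rule M.submoduleI)
    show "total_reduced \<subseteq> carrier M" using sub by blast
    show "\<zero>\<^bsub>M\<^esub> \<in> total_reduced"
      using total_zero_closed zero_cochain_reduced unfolding total_reduced_def by (simp add: total_zero)
    show "\<ominus>\<^bsub>M\<^esub> F \<in> total_reduced" if F: "F \<in> total_reduced" for F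
      using smult[OF _ F, of "\<ominus>\<^bsub>K\<^esub> \<one>\<^bsub>K\<^esub>"] sub[OF F] by (simp add: M.smult_l_minus)
    show "F \<oplus>\<^bsub>M\<^esub> G \<in> total_reduced" if F: "F \<in> total_reduced" and G: "G \<in> total_reduced" for F G
    proof -
      have "(F \<oplus>\<^bsub>M\<^esub> G) p q \<in> reduced_cochains p q" for p q
        unfolding total_add
      proof (rule reduced_cochainI)
        fix \<phi> assume \<phi>: "\<phi> \<in> strings C p"
        show "multilinear K q (src \<phi>) (tgt \<phi>) (\<lambda>vs. F p q \<phi> vs \<oplus>\<^bsub>tgt \<phi>\<^esub> G p q \<phi> vs)"
          by (rule multilinear_add[OF module_src[OF \<phi>] module_tgt[OF \<phi>]
                cochain_multilinear[OF reduced_cochain[OF red[OF F]] \<phi>]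
                cochain_multilinear[OF reduced_cochain[OF red[OF G]] \<phi>]])
        interpret Y: module K "tgt \<phi>" by (rule module_tgt[OF \<phi>])
        show "F p q \<phi> vs \<oplus>\<^bsub>tgt \<phi>\<^esub> G p q \<phi> vs = \<zero>\<^bsub>tgt \<phi>\<^esub>"
          if "degenerate \<phi>" "vs \<in> tuples q (src \<phi>)" for vs
          using reduced_cochain_degenerate[OF red[OF F] \<phi> that] reduced_cochain_degenerate[OF red[OF G] \<phi> that]
          by simp
      qed
      then show ?thesis using total_add_closed[OF sub[OF F] sub[OF G]] unfolding total_reduced_def by blast
    qed
  qed (use smult in blast)
qed

text \<open>The support is shifted by one in the first degree and can only shrink otherwise, by
  \<open>delta_S_zero\<close>.\<close>

lemma total_delta_S_reduced:
  assumes "F \<in> total_reduced"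
  shows "total_delta_S F \<in> total_reduced"
  unfolding total_reduced_iff
proof (intro conjI allI)
  have F: "F p q \<in> reduced_cochains p q" "finite {(p, q). F p q \<noteq> zero_cochain p q}" for p q
    using assms unfolding total_reduced_iff by blast+
  show "total_delta_S F p q \<in> reduced_cochains p q" for p q
    unfolding total_delta_S_def
    by (cases p) (simp_all add: zero_cochain_reduced delta_S_reduced F(1))
  have "{(p, q). total_delta_S F p q \<noteq> zero_cochain p q}
    \<subseteq> (\<lambda>(p, q). (Suc p, q)) ` {(p, q). F p q \<noteq> zero_cochain p q}"
  proof clarify
    fix p q assume nz: "total_delta_S F p q \<noteq> zero_cochain p q"
    then obtain p' where p': "p = Suc p'" by (cases p) (auto simp: total_delta_S_def)
    have "F p' q \<noteq> zero_cochain p' q"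
    proof
      assume "F p' q = zero_cochain p' q"
      then show False using nz p' by (simp add: total_delta_S_def delta_S_zero)
    qed
    then show "(p, q) \<in> (\<lambda>(p, q). (Suc p, q)) ` {(p, q). F p q \<noteq> zero_cochain p q}"
      using p' by (intro image_eqI[of _ _ "(p', q)"]) auto
  qed
  then show "finite {(p, q). total_delta_S F p q \<noteq> zero_cochain p q}"
    using F(2) finite_subset by blast
qed

text \<open>The conditions on \<open>P\<close> and \<open>R\<close> are integer equations between
  nonnegative numbers, so for the indices of the sum the truncated subtraction in
  \<open>out_p\<close> and the conversion by \<open>nat\<close> are exact.\<close>

lemma op_bidegrees_out:
  assumes "(p, q) \<in> op_bidegrees n Q F P R"
  shows "P = out_p n (fst Q) p" "R = nat (out_q n q)"
proof -
  have "int P = int (\<Sum>a\<in>{1..n}. p a) - int (word_deg n (fst Q))" "int R = out_q n q"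
    using assms by (auto simp: op_bidegrees_def)
  then show "P = out_p n (fst Q) p" "R = nat (out_q n q)" unfolding out_p_def by linarith+
qed

text \<open>For fixed output bidegree all summands are reduced cochains of that same bidegree.
  Finite support holds because the output bidegree is a function of the chosen input bidegrees, and
  each \<open>F a\<close> offers finitely many.\<close>

lemma total_quilt_op_reduced:
  assumes Q: "Q \<in> Quilt n" and F: "\<And>a. a \<in> {1..n} \<Longrightarrow> F a \<in> total_reduced"
  shows "total_quilt_op n Q F \<in> total_reduced"
  unfolding total_reduced_iff
proof (intro conjI allI)
  have red: "F a p q \<in> reduced_cochains p q" and fin: "finite {(p, q). F a p q \<noteq> zero_cochain p q}"
    if "a \<in> {1..n}" for a p q
    using F[OF that] unfolding total_reduced_iff by blast+
  show "total_quilt_op n Q F P R \<in> reduced_cochains P R" for P R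
    unfolding total_quilt_op_def
  proof (rule reduced_cochainI)
    have op: "quilt_op n Q (fst pq) (snd pq) (\<lambda>a. F a (fst pq a) (snd pq a)) \<in> reduced_cochains P R"
      if "pq \<in> op_bidegrees n Q F P R" for pq
    proof -
      have "(fst pq, snd pq) \<in> op_bidegrees n Q F P R" using that by simp
      note out = op_bidegrees_out[OF this]
      show ?thesis unfolding out by (rule quilt_op_reduced[OF Q]) (rule red)
    qed
    fix \<phi> assume \<phi>: "\<phi> \<in> strings C P"
    show "multilinear K R (src \<phi>) (tgt \<phi>) (\<lambda>vs. \<Oplus>\<^bsub>tgt \<phi>\<^esub>pq\<in>op_bidegrees n Q F P R.
        quilt_op n Q (fst pq) (snd pq) (\<lambda>a. F a (fst pq a) (snd pq a)) \<phi> vs)"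
      by (rule multilinear_finsum[OF module_src[OF \<phi>] module_tgt[OF \<phi>]
            cochain_multilinear[OF reduced_cochain[OF op] \<phi>]])
    interpret Y: module K "tgt \<phi>" by (rule module_tgt[OF \<phi>])
    show "(\<Oplus>\<^bsub>tgt \<phi>\<^esub>pq\<in>op_bidegrees n Q F P R.
        quilt_op n Q (fst pq) (snd pq) (\<lambda>a. F a (fst pq a) (snd pq a)) \<phi> vs) = \<zero>\<^bsub>tgt \<phi>\<^esub>"
      if "degenerate \<phi>" "vs \<in> tuples R (src \<phi>)" for vs
      by (intro Y.M.add.finprod_one_eqI reduced_cochain_degenerate[OF op \<phi> that])
  qed
  \<comment> \<open>\<open>?D\<close> is a finite box containing all admissible choices: it lets the
    first and second degrees vary independently over the projections of each support.\<close>
  let ?B = "\<lambda>a. {(p, q). F a p q \<noteq> zero_cochain p q}"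
  let ?D = "(\<Pi>\<^sub>E a\<in>{1..n}. fst ` ?B a) \<times> (\<Pi>\<^sub>E a\<in>{1..n}. snd ` ?B a)"
  have "finite ?D" using fin by (intro finite_cartesian_product finite_PiE finite_imageI) auto
  moreover have "{(P, R). total_quilt_op n Q F P R \<noteq> zero_cochain P R}
    \<subseteq> (\<lambda>(p, q). (out_p n (fst Q) p, nat (out_q n q))) ` ?D"
  proof clarify
    fix P R assume nz: "total_quilt_op n Q F P R \<noteq> zero_cochain P R"
    have "op_bidegrees n Q F P R \<noteq> {}"
    proof
      assume "op_bidegrees n Q F P R = {}"
      then have "total_quilt_op n Q F P R = zero_cochain P R"
        unfolding total_quilt_op_def zero_cochain_def
      proof (intro restrict_ext)
        fix \<phi> vs assume empty: "op_bidegrees n Q F P R = {}" and \<phi>: "\<phi> \<in> strings C P"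
        interpret Y: module K "tgt \<phi>" by (rule module_tgt[OF \<phi>])
        show "(\<Oplus>\<^bsub>tgt \<phi>\<^esub>pq\<in>op_bidegrees n Q F P R.
          quilt_op n Q (fst pq) (snd pq) (\<lambda>a. F a (fst pq a) (snd pq a)) \<phi> vs) = \<zero>\<^bsub>tgt \<phi>\<^esub>"
          unfolding empty by (rule Y.M.finsum_empty)
      qed
      then show False using nz by simp
    qed
    then obtain p q where pq: "(p, q) \<in> op_bidegrees n Q F P R" by auto
    have nz: "(p a, q a) \<in> ?B a" if "a \<in> {1..n}" for a
      using pq that by (auto simp: op_bidegrees_def)
    have ext: "p \<in> extensional {1..n}" "q \<in> extensional {1..n}"
      using pq by (auto simp: op_bidegrees_def PiE_def)
    have "p a \<in> fst ` ?B a" "q a \<in> snd ` ?B a" if "a \<in> {1..n}" for a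
      using nz[OF that] by force+
    then have "(p, q) \<in> ?D" using ext by (auto simp: PiE_def)
    then show "(P, R) \<in> (\<lambda>(p, q). (out_p n (fst Q) p, nat (out_q n q))) ` ?D"
      using op_bidegrees_out[OF pq] by (intro image_eqI[of _ _ "(p, q)"]) auto
  qed
  ultimately show "finite {(P, R). total_quilt_op n Q F P R \<noteq> zero_cochain P R}"
    using finite_subset by blast
qed

end

theorem theorem4p30:
  fixes C :: "('o, 'm) cat" and K :: "'k ring"
    and V :: "'o \<Rightarrow> ('k, 'v) module" and A :: "'m \<Rightarrow> 'v \<Rightarrow> 'v"
  assumes "vec_functor C K V A"
  shows "vec_functor.quilt_subalgebra C K V A (vec_functor.total_reduced C K V)"
proof -
  interpret vec_functor C K V A by fact
  show ?thesis unfolding quilt_subalgebra_def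
    using submodule_total_reduced total_delta_S_reduced total_quilt_op_reduced by blast
qed

end
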